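(* Let $H(u,v)$ denote the hitting time of the random walk on $\Gamma=(V,E)$ from vertex $u$ to vertex $v$. (i) If $\Gamma$ is a weighted strongly-connected digraph, then for all $u,v\in V$ $$H(u,v)=\frac{1}{\tau_v}\sum_{\substack{T_1\cup T_2\in \mathbb{F}^*_2\\ u\in T_2,\ v=r(T_1)}} d_{r(T_2)}\,\omega(T_1\cup T_2).$$ (ii) If, in addition to the hypothesis of (i), $e=(v,u)$ is an edge of $\Gamma$, then $$H(u,v)=\frac{1}{\tau_v\,\omega(e)}\sum_{T\in\mathbb{T}^*_e} d_{r(T)}\,\omega(T),$$ where $\mathbb{T}^*_e$ denotes the set of all spanning in-trees (rooted spanning trees) of $\Gamma$ containing the edge $e$. (iii) If $\Gamma$ is a weighted connected undirected graph, then for all $u,v\in V$ $$H(u,v)=\frac{1}{\tau}\sum_{\substack{T_1\cup T_2\in\mathbb{F}_2\\ u\in T_2,\ v\in T_1}}\mathrm{vol}(T_2)\,\omega(T_1\cup T_2).$$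
   Context: A weighted digraph $\Gamma=(V,E)$ is finite with at least two vertices, has no loops, and has at most one edge $(u,v)$ for each ordered pair of distinct vertices; each edge $e=(u,v)\in E$ has a weight $\omega(e)=\omega(u,v)>0$, and $\omega(u,v)=0$ if $(u,v)\notin E$. A weighted undirected graph is the case of symmetric weights $\omega(u,v)=\omega(v,u)$, with $\{u,v\}$ regarded as a single undirected edge when speaking of unrooted forests. With $A(u,v)=\omega(u,v)$, $d_u=\sum_v\omega(u,v)$ (the (out-)degree) and $D=\mathrm{Diag}[d_u]$, the random walk on $\Gamma$ has transition probability matrix $P=D^{-1}A$. The hitting time $H(u,v)$ is the expected number of steps of the random walk started at $u$ until it first reaches $v$ (so $H(v,v)=0$). $\mathrm{vol}(U)=\sum_{z\in U}d_z$ with degrees taken in $\Gamma$; for a subgraph $T$, $\mathrm{vol}(T)$ is the volume of its vertex set. A rooted $k$-forest is a digraph whose underlying undirected graph is a forest with $k$ connected components (no cycles; in particular it does not contain both $(u,v)$ and $(v,u)$) and such that each weakly-connected component has a vertex, its root, to which every vertex of that component has a unique directed path. A rooted $1$-forest is called an in-tree or rooted tree; its root is $r(T)$. A subgraph is spanning if it contains all vertices of $\Gamma$. $\mathbb{F}^*_k$ is the set of spanning rooted $k$-forests of $\Gamma$; for undirected $\Gamma$, $\mathbb{F}_k$ is the set of unrooted spanning $k$-forests (acyclic spanning subgraphs with exactly $k$ connected components). A $2$-forest is written $T_1\cup T_2$, where $T_1,T_2$ are its components, with roots $r(T_1),r(T_2)$ if rooted. The order of $T_1$ and $T_2$ is irrelevant: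 a sum ranges over forests, each counted once, with the components named so that the condition under the sum holds. The weight of a forest is $\omega(F)=\prod_{e\in E(F)}\omega(e)$; $\tau_w=\sum_{T\in\mathbb{F}^*_1,\ r(T)=w}\omega(T)$ is the total weight of the rooted spanning trees with root $w$; for undirected $\Gamma$, $\tau$ is the total weight of all unrooted spanning trees. *)

theory Defs
  imports "HOL-Probability.Probability" "Graph_Theory.Digraph_Component"
begin

text \<open>
  Digraphs without parallel arcs are those of the theory Pair_Digraph; the coercion
  \<^const>\<open>with_proj\<close> views them as general digraphs.  An undirected graph is a symmetric digraph.
\<close>

locale weighted_digraph = pair_digraph G
  for G :: "'v pair_pre_digraph" and \<omega> :: "('v \<times> 'v) \<Rightarrow> real" +
  assumes at_least_two_verts: "2 \<le> card (pverts G)"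
    and weight_pos: "e \<in> parcs G \<Longrightarrow> 0 < \<omega> e"
    and weight_zero: "e \<notin> parcs G \<Longrightarrow> \<omega> e = 0"

locale weighted_graph = weighted_digraph G \<omega>
  for G :: "'v pair_pre_digraph" and \<omega> :: "('v \<times> 'v) \<Rightarrow> real" +
  assumes weight_sym: "\<omega> (a, b) = \<omega> (b, a)"

definition wdegree :: "'v pair_pre_digraph \<Rightarrow> ('v \<times> 'v \<Rightarrow> real) \<Rightarrow> 'v \<Rightarrow> real" where
  "wdegree G \<omega> a = (\<Sum>b\<in>pverts G. \<omega> (a, b))"

definition vol :: "'v pair_pre_digraph \<Rightarrow> ('v \<times> 'v \<Rightarrow> real) \<Rightarrow> 'v set \<Rightarrow> real" where
  "vol G \<omega> U = (\<Sum>z\<in>U. wdegree G \<omega> z)"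


section \<open>Random walk and hitting times\<close>

text \<open>
  The row of \<open>P = D\<^sup>-\<^sup>1 A\<close> at \<open>a\<close>.  It is a probability distribution, and hence
  \<^const>\<open>embed_pmf\<close> is meaningful, when \<open>a\<close> is a vertex of nonzero degree
  (lemma \<open>pmf_rw_step\<close>); in a strongly connected weighted digraph this
  holds at every vertex.
\<close>
definition rw_step :: "'v pair_pre_digraph \<Rightarrow> ('v \<times> 'v \<Rightarrow> real) \<Rightarrow> 'v \<Rightarrow> 'v pmf" where
  "rw_step G \<omega> a = embed_pmf (\<lambda>b. \<omega> (a, b) / wdegree G \<omega> a)"

lemma (in weighted_digraph) pmf_rw_step:
  assumes "a \<in> pverts G" and "wdegree G \<omega> a \<noteq> 0"
  shows "pmf (rw_step G \<omega> a) b = \<omega> (a, b) / wdegree G \<omega> a"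
proof -
  have nonneg: "0 \<le> \<omega> e" for e
    using weight_pos[of e] weight_zero[of e] by (cases "e \<in> parcs G") auto
  then have deg: "0 \<le> wdegree G \<omega> a"
    by (auto simp: wdegree_def intro: sum_nonneg)
  have zero: "\<omega> (a, b) = 0" if "b \<notin> pverts G" for b
    using that weight_zero[of "(a, b)"] in_arcsD2[of a b] by blast
  have "(\<integral>\<^sup>+ b. ennreal (\<omega> (a, b) / wdegree G \<omega> a) \<partial>count_space UNIV)
      = (\<Sum>b\<in>pverts G. ennreal (\<omega> (a, b) / wdegree G \<omega> a))"
    using pair_finite_verts zero
    by (intro nn_integral_count_space'[THEN trans]) auto
  also have "\<dots> = ennreal (\<Sum>b\<in>pverts G. \<omega> (a, b) / wdegree G \<omega> a)"
    using nonneg deg by (intro sum_ennreal) auto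
  also have "(\<Sum>b\<in>pverts G. \<omega> (a, b) / wdegree G \<omega> a) = 1"
    using assms(2) by (simp add: sum_divide_distrib[symmetric]) (simp add: wdegree_def)
  finally show ?thesis
    unfolding rw_step_def using nonneg deg by (intro pmf_embed_pmf) auto
qed

text \<open>The conditional law of the position at time \<open>n\<close>, given the positions \<open>X\<close> before time \<open>n\<close>.\<close>
definition rw_kernel ::
    "'v pair_pre_digraph \<Rightarrow> ('v \<times> 'v \<Rightarrow> real) \<Rightarrow> 'v \<Rightarrow> nat \<Rightarrow> (nat \<Rightarrow> 'v) \<Rightarrow> 'v measure" where
  "rw_kernel G \<omega> u n X =
     measure_pmf (case n of 0 \<Rightarrow> return_pmf u | Suc m \<Rightarrow> rw_step G \<omega> (X m))"

lemma Ionescu_Tulcea_rw_kernel: "Ionescu_Tulcea (rw_kernel G \<omega> u) (\<lambda>_. count_space UNIV)"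
proof (rule Ionescu_Tulcea.intro)
  show "rw_kernel G \<omega> u i \<in>
      measurable (PiM {0..<i} (\<lambda>_. count_space UNIV)) (subprob_algebra (count_space UNIV))" for i
  proof (cases i)
    case 0
    then show ?thesis
      by (auto simp: rw_kernel_def[abs_def] intro!: measurable_const measure_pmf_in_subprob_algebra)
  next
    case (Suc m)
    have "(\<lambda>X. measure_pmf (rw_step G \<omega> (X m))) \<in>
      measurable (PiM {0..<i} (\<lambda>_. count_space UNIV)) (subprob_algebra (count_space UNIV))"
      by (rule measurable_compose[where N="count_space UNIV"])
         (auto simp: Suc intro!: measurable_component_singleton measure_pmf_in_subprob_algebra)
    then show ?thesis
      by (simp add: rw_kernel_def[abs_def] Suc)
  qed
  show "prob_space (rw_kernel G \<omega> u i X)" for i X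
    by (simp add: rw_kernel_def measure_pmf.prob_space_axioms)
qed

text \<open>
  The law of the random walk started at \<open>u\<close>: the probability measure on the
  trajectories \<open>nat \<Rightarrow> 'v\<close> which the Ionescu-Tulcea theorem yields from the kernels above.
\<close>
definition random_walk ::
    "'v pair_pre_digraph \<Rightarrow> ('v \<times> 'v \<Rightarrow> real) \<Rightarrow> 'v \<Rightarrow> (nat \<Rightarrow> 'v) measure" where
  "random_walk G \<omega> u =
     projective_family.lim UNIV
       (Ionescu_Tulcea.CI (rw_kernel G \<omega> u) (\<lambda>_. count_space UNIV)) (\<lambda>_. count_space UNIV)"

text \<open>
  The finite-dimensional distributions of \<^const>\<open>random_walk\<close> are those of the Markov chain
  with initial state \<open>u\<close> and transition probabilities \<^const>\<open>rw_step\<close>.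
\<close>
lemma emeasure_random_walk_path:
  fixes G :: "'a pair_pre_digraph"
  shows "emeasure (random_walk G \<omega> u) {X. \<forall>i\<le>n. X i = x i} =
     (if x 0 = u then (\<Prod>i<n. ennreal (pmf (rw_step G \<omega> (x i)) (x (Suc i)))) else 0)"
proof -
  interpret Ionescu_Tulcea "rw_kernel G \<omega> u" "\<lambda>_. count_space UNIV"
    by (rule Ionescu_Tulcea_rw_kernel)
  let ?M = "\<lambda>_::nat. count_space (UNIV :: 'a set)"
  define y where "y n = restrict x {0..<n}" for n
  have y_sets: "{y n} \<in> sets (PiM {0..<n} ?M)" for n
  proof -
    have "PiE {0..<n} (\<lambda>i. {y n i}) = {y n}"
      by (rule PiE_singleton) (simp add: y_def extensional_def)
    moreover have "PiE {0..<n} (\<lambda>i. {y n i}) \<in> sets (PiM {0..<n} ?M)"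
      by (rule sets_PiM_I_finite) auto
    ultimately show ?thesis by simp
  qed
  have y_space: "y n \<in> space (PiM {0..<n} ?M)" for n
    by (auto simp: y_def space_PiM)
  have eP: "emeasure (eP n z) {y (Suc n)} =
      emeasure (rw_kernel G \<omega> u n (y n)) {x n} * indicator {y n} z"
    if z: "z \<in> space (PiM {0..<n} ?M)" for n z
  proof -
    have "emeasure (eP n z) {y (Suc n)} =
        rw_kernel G \<omega> u n z ((\<lambda>a. fun_upd z n a) -` {y (Suc n)} \<inter> space (count_space UNIV))"
      by (rule emeasure_eP[OF z y_sets])
    also have "(\<lambda>a. fun_upd z n a) -` {y (Suc n)} \<inter> space (count_space UNIV) =
        (if z = y n then {x n} else {})"
    proof -
      have "z(n := a) = y (Suc n) \<longleftrightarrow> a = x n \<and> z = y n" for a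
        using z unfolding y_def space_PiM PiE_iff extensional_def fun_eq_iff restrict_def
        by (auto simp: less_Suc_eq)
      then show ?thesis by auto
    qed
    finally show ?thesis by auto
  qed
  have C: "emeasure (C 0 n (\<lambda>_. undefined)) {y n} =
      (\<Prod>i<n. emeasure (rw_kernel G \<omega> u i (y i)) {x i})" for n
  proof (induction n)
    case 0
    have "(\<lambda>_. undefined) = y 0" by (auto simp: y_def restrict_def)
    then show ?case
      using y_sets[of 0] y_space[of 0] by simp
  next
    case (Suc n)
    have u: "(\<lambda>_. undefined) \<in> space (PiM {0..<0} ?M)" by (simp add: space_PiM)
    have "emeasure (C 0 (Suc n) (\<lambda>_. undefined)) {y (Suc n)} =
        (\<integral>\<^sup>+z. emeasure (eP n z) {y (Suc n)} \<partial>C 0 n (\<lambda>_. undefined))"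
      using u y_sets[of "Suc n"]
      by (simp, subst emeasure_bind[where N="PiM {0..<Suc n} ?M"])
         (auto simp: space_C[OF u, simplified] space_PiM measurable_cong_sets[OF sets_C[OF u] refl] 
            simp del: C.simps intro!: measurable_eP)
    also have "\<dots> = (\<integral>\<^sup>+z. emeasure (rw_kernel G \<omega> u n (y n)) {x n} * indicator {y n} z
        \<partial>C 0 n (\<lambda>_. undefined))"
      using space_C[OF u, of n] by (intro nn_integral_cong eP) auto
    also have "\<dots> = emeasure (rw_kernel G \<omega> u n (y n)) {x n} * emeasure (C 0 n (\<lambda>_. undefined)) {y n}"
      using sets_C[OF u, of n] y_sets[of n] by (intro nn_integral_cmult_indicator) simp
    finally show ?case
      by (simp add: Suc mult.commute del: C.simps)
  qed
  have "{X. \<forall>i\<le>n. X i = x i} = PF.emb UNIV {0..<Suc n} {y (Suc n)}"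
    by (auto simp: prod_emb_def y_def restrict_def fun_eq_iff less_Suc_eq_le split: if_splits)
  then have "emeasure (random_walk G \<omega> u) {X. \<forall>i\<le>n. X i = x i} = 
      emeasure (CI {0..<Suc n}) {y (Suc n)}"
    unfolding random_walk_def using lim[of "{0..<Suc n}", OF _ y_sets] by simp
  also have "\<dots> = emeasure (C 0 (Suc n) (\<lambda>_. undefined)) {y (Suc n)}"
    by (subst emeasure_CI[OF order_refl y_sets]) (simp only: prod_emb_id[OF sets.sets_into_space[OF y_sets, unfolded space_PiM]])
  also have "\<dots> = (\<Prod>i<Suc n. emeasure (rw_kernel G \<omega> u i (y i)) {x i})"
    by (rule C)
  also have "\<dots> = emeasure (rw_kernel G \<omega> u 0 (y 0)) {x 0} * 
      (\<Prod>i<n. emeasure (rw_kernel G \<omega> u (Suc i) (y (Suc i))) {x (Suc i)})"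
    by (rule prod.lessThan_Suc_shift)
  also have "\<dots> = (if x 0 = u then (\<Prod>i<n. ennreal (pmf (rw_step G \<omega> (x i)) (x (Suc i)))) else 0)"
    by (auto simp: rw_kernel_def y_def emeasure_pmf_single indicator_def)
  finally show ?thesis .
qed

text \<open>The first time at which the trajectory \<open>X\<close> is at \<open>v\<close>; it is \<open>\<infinity>\<close> if \<open>X\<close> never reaches \<open>v\<close>.\<close>
definition first_hit :: "'v \<Rightarrow> (nat \<Rightarrow> 'v) \<Rightarrow> enat" where
  "first_hit v X = (INF n\<in>{n. X n = v}. enat n)"

definition hitting_time ::
    "'v pair_pre_digraph \<Rightarrow> ('v \<times> 'v \<Rightarrow> real) \<Rightarrow> 'v \<Rightarrow> 'v \<Rightarrow> ennreal" where
  "hitting_time G \<omega> u v =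
     (\<integral>\<^sup>+ X. ennreal_of_enat (first_hit v X) \<partial>random_walk G \<omega> u)"


section \<open>Forests\<close>

definition weak_components :: "'v pair_pre_digraph \<Rightarrow> 'v set set" where
  "weak_components F = pre_digraph.sccs_verts (with_proj (mk_symmetric F))"

text \<open>
  The underlying undirected graph of \<open>F\<close> has no cycle and exactly \<open>k\<close> connected components.
  In the symmetric digraph \<^term>\<open>mk_symmetric (with_proj F)\<close> every edge gives rise to the directed
  cycle \<open>a, b, a\<close>, which is not a cycle of the undirected graph; the cycles of the undirected graph
  are those of length at least 3.  For this reason \<^const>\<open>forest\<close> cannot be used here.
\<close>
definition undirected_forest :: "nat \<Rightarrow> 'v pair_pre_digraph \<Rightarrow> bool" where
  "undirected_forest k F \<longleftrightarrow>
     \<not> (\<exists>p. pre_digraph.cycle (with_proj (mk_symmetric F)) p \<and> 3 \<le> length p) \<and>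
     card (weak_components F) = k"

definition is_root :: "'v pair_pre_digraph \<Rightarrow> 'v set \<Rightarrow> 'v \<Rightarrow> bool" where
  "is_root F C r \<longleftrightarrow> r \<in> C \<and> (\<forall>a\<in>C. \<exists>!p. pre_digraph.apath (with_proj F) a p r)"

definition component_root :: "'v pair_pre_digraph \<Rightarrow> 'v set \<Rightarrow> 'v" where
  "component_root F C = (THE r. is_root F C r)"

definition tree_root :: "'v pair_pre_digraph \<Rightarrow> 'v" where
  "tree_root T = component_root T (pverts T)"

text \<open>Antiparallel arcs are excluded explicitly, since \<^const>\<open>mk_symmetric\<close> identifies them.\<close>
definition rooted_forests :: "'v pair_pre_digraph \<Rightarrow> nat \<Rightarrow> 'v pair_pre_digraph set" where
  "rooted_forests G k =
     {F. spanning (with_proj F) (with_proj G) \<and> undirected_forest k F \<and>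
         (\<forall>a b. (a, b) \<in> parcs F \<longrightarrow> (b, a) \<notin> parcs F) \<and>
         (\<forall>C\<in>weak_components F. \<exists>r. is_root F C r)}"

text \<open>
  For an undirected (symmetric) \<open>G\<close>: a subgraph is again a symmetric digraph, in which an
  undirected edge is a pair of antiparallel arcs.
\<close>
definition unrooted_forests :: "'v pair_pre_digraph \<Rightarrow> nat \<Rightarrow> 'v pair_pre_digraph set" where
  "unrooted_forests G k = {F. spanning (with_proj F) (with_proj G) \<and> symmetric (with_proj F) \<and> undirected_forest k F}"

definition forest_weight :: "('v \<times> 'v \<Rightarrow> real) \<Rightarrow> 'v pair_pre_digraph \<Rightarrow> real" where
  "forest_weight \<omega> F = (\<Prod>e\<in>parcs F. \<omega> e)"

text \<open>The weight of the undirected edge \<open>{a, b}\<close>; well-defined for symmetric weights.\<close>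
definition undirected_edge_weight :: "('v \<times> 'v \<Rightarrow> real) \<Rightarrow> 'v set \<Rightarrow> real" where
  "undirected_edge_weight \<omega> e = (THE c. \<exists>a b. e = {a, b} \<and> c = \<omega> (a, b))"

text \<open>Each undirected edge contributes one factor, although it consists of two arcs.\<close>
definition undirected_forest_weight :: "('v \<times> 'v \<Rightarrow> real) \<Rightarrow> 'v pair_pre_digraph \<Rightarrow> real" where
  "undirected_forest_weight \<omega> F =
     (\<Prod>e\<in>{{a, b} | a b. (a, b) \<in> parcs F}. undirected_edge_weight \<omega> e)"

definition rooted_tree_weight ::
    "'v pair_pre_digraph \<Rightarrow> ('v \<times> 'v \<Rightarrow> real) \<Rightarrow> 'v \<Rightarrow> real" where
  "rooted_tree_weight G \<omega> w =
     (\<Sum>T\<in>{T \<in> rooted_forests G 1. tree_root T = w}. forest_weight \<omega> T)"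

definition spanning_tree_weight :: "'v pair_pre_digraph \<Rightarrow> ('v \<times> 'v \<Rightarrow> real) \<Rightarrow> real" where
  "spanning_tree_weight G \<omega> = (\<Sum>T\<in>unrooted_forests G 1. undirected_forest_weight \<omega> T)"

definition trees_containing :: "'v pair_pre_digraph \<Rightarrow> 'v \<times> 'v \<Rightarrow> 'v pair_pre_digraph set" where
  "trees_containing G e = {T \<in> rooted_forests G 1. e \<in> parcs T}"

text \<open>
  The index sets of the sums over 2-forests.  A forest is listed together with the naming
  \<open>T\<^sub>1\<close>, \<open>T\<^sub>2\<close> of (the vertex sets of) its two components for which the condition holds.  As the
  components are disjoint, \<open>u \<in> T\<^sub>2\<close> leaves at most one such naming, and so each
  forest is counted once.
\<close>
definition rooted_2_forests_sep ::
    "'v pair_pre_digraph \<Rightarrow> 'v \<Rightarrow> 'v \<Rightarrow> ('v pair_pre_digraph \<times> 'v set \<times> 'v set) set" where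
  "rooted_2_forests_sep G u v =
     {(F, T1, T2). F \<in> rooted_forests G 2 \<and> weak_components F = {T1, T2} \<and>
        u \<in> T2 \<and> v = component_root F T1}"

definition unrooted_2_forests_sep ::
    "'v pair_pre_digraph \<Rightarrow> 'v \<Rightarrow> 'v \<Rightarrow> ('v pair_pre_digraph \<times> 'v set \<times> 'v set) set" where
  "unrooted_2_forests_sep G u v =
     {(F, T1, T2). F \<in> unrooted_forests G 2 \<and> weak_components F = {T1, T2} \<and>
        u \<in> T2 \<and> v \<in> T1}"

end

theory Submission
  imports Defs
begin

text \<open>
  Fix a target \<open>v\<close>. Conditioning on the first step of the walk shows that the hitting times satisfy
  \<open>H(v) = 0\<close> and \<open>d\<^sub>u H(u) = d\<^sub>u + (\<Sum>w. \<omega>(u, w) H(w))\<close> for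
  \<open>u \<noteq> v\<close>. Every nonnegative real solution of this system is equal to the hitting time
  (\<open>hitting_time_unique_solution\<close>): \<open>H\<close> is the least solution, and the difference of
  two solutions is harmonic outside \<open>v\<close> and zero at \<open>v\<close>, so that it vanishes by the
  maximum principle. It remains to show that the sum over 2-forests, divided by \<open>\<tau>\<^sub>v\<close>,
  is a solution.

  For this, a rooted forest is replaced by its set of arcs. These sets are the single-valued acyclic relations,
  and the roots are the vertices without out-arc (\<open>rooted_forests_eq\<close>). Let
  \<open>N\<^sub>r(x)\<close> be the weight of the forests with roots \<open>v\<close> and \<open>r\<close> in
  which \<open>x\<close> belongs to the tree of \<open>r\<close>, so that the sum over 2-forests is \<open>S(x)
  = (\<Sum>r. d\<^sub>r N\<^sub>r(x))\<close>. A forest in which \<open>u\<close> is not a root arises in a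
  unique way from a forest in which \<open>u\<close> is an additional root, by adding an arc \<open>(u,
  x)\<close> to a vertex of a different tree (\<open>sum_in_forests_cut\<close>). With this cut at
  \<open>u\<close>, the sum \<open>(\<Sum>w. \<omega>(u, w) (N\<^sub>r(u) - N\<^sub>r(w)))\<close> for \<open>r
  \<noteq> u\<close> becomes a double sum over \<open>x\<close> and \<open>w\<close> that is antisymmetric and
  hence zero (\<open>sep_sum_balance\<close>); for \<open>r = u\<close> it counts every spanning tree with root
  \<open>v\<close> once and is therefore \<open>\<tau>\<^sub>v\<close> (\<open>sep_sum_at_root\<close>).
  Multiplication by \<open>d\<^sub>r\<close> and summation over \<open>r\<close> gives the required system
  (\<open>sep_sum_system\<close>), and \<open>\<tau>\<^sub>v > 0\<close> by strong connectivity.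

  The other two formulas are bijective consequences of the first. A spanning tree that contains the arc
  \<open>(v, u)\<close> and has root \<open>r\<close> is cut at \<open>v\<close> into a forest with roots
  \<open>v\<close> and \<open>r\<close> in which \<open>u\<close> belongs to the tree of \<open>r\<close>. In
  the undirected case, a forest together with a choice of one vertex in each component has a unique orientation
  with these vertices as roots (\<open>orient_in_forests\<close>, \<open>orient_symcl\<close>,
  \<open>symcl_in_forest\<close>). So \<open>\<tau> = \<tau>\<^sub>v\<close>, and the sum of
  \<open>d\<^sub>r\<close> over the possible roots \<open>r\<close> of the component of \<open>u\<close> is the
  volume of this component.
\<close>

section \<open>Rooted forests as sets of arcs\<close>

text \<open>
  In a rooted forest every vertex has at most one out-arc, and the roots are the vertices without one. On the
  finite vertex set \<open>V\<close>, the conditions below therefore describe exactly the arc sets of the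
  spanning forests with arcs in \<open>E\<close> and root set \<open>R\<close>: following the out-arcs leads
  from every vertex to a root.
\<close>
definition in_forests :: "'v set \<Rightarrow> 'v rel \<Rightarrow> 'v set \<Rightarrow> 'v rel set" where
  "in_forests V E R = {A. A \<subseteq> E \<and> single_valued A \<and> acyclic A \<and> Domain A = V - R}"

text \<open>
  This is confluence: two paths that start in the same vertex of a single-valued relation agree up to the end of
  the shorter one. It is what turns weak connectivity in a rooted forest into a common root.
\<close>
lemma single_valued_connected_imp_joinable:
  assumes "single_valued A" and "(x, y) \<in> (A \<union> A\<inverse>)\<^sup>*"
  shows "\<exists>z. (x, z) \<in> A\<^sup>* \<and> (y, z) \<in> A\<^sup>*"
  using assms(2)
proof (induction rule: rtrancl_induct)
  case base
  then show ?case by blast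
next
  case (step y y')
  then obtain z where z: "(x, z) \<in> A\<^sup>*" "(y, z) \<in> A\<^sup>*" by blast
  from step(2) show ?case
  proof
    assume yy': "(y, y') \<in> A"
    show ?thesis
      using z(2)
    proof (cases rule: converse_rtranclE)
      case base
      then show ?thesis using yy' z(1) by (blast intro: rtrancl_into_rtrancl)
    next
      case (step y'')
      then have "y'' = y'" using yy' assms(1) by (blast dest: single_valuedD)
      then show ?thesis using step z(1) by blast
    qed
  next
    assume "(y, y') \<in> A\<inverse>"
    then show ?thesis using z by (blast intro: converse_rtrancl_into_rtrancl)
  qed
qed

lemma rtrancl_from_sink: "(x, y) \<in> A\<^sup>* \<Longrightarrow> x \<notin> Domain A \<Longrightarrow> y = x"
  by (auto elim: converse_rtranclE)

lemma ex_reachable_sink: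
  assumes "finite A" "acyclic A"
  shows "\<exists>r. (x, r) \<in> A\<^sup>* \<and> r \<notin> Domain A"
proof -
  have "wf (A\<inverse>)"
    using assms by (rule finite_acyclic_wf_converse)
  then show ?thesis
  proof (induction x rule: wf_induct_rule)
    case (less x)
    show ?case
    proof (cases "x \<in> Domain A")
      case True
      then obtain y where "(x, y) \<in> A" by blast
      with less[of y] show ?thesis by (auto intro: converse_rtrancl_into_rtrancl)
    qed blast
  qed
qed

lemma reachable_sink_unique:
  assumes "single_valued A" "(x, r) \<in> A\<^sup>*" "(x, s) \<in> A\<^sup>*" "r \<notin> Domain A" "s \<notin> Domain A"
  shows "r = s"
  using single_valued_confluent[OF assms(1-3)] assms(4,5) by (auto dest: rtrancl_from_sink)

lemma rtrancl_without_leaving_target: "(y, x) \<in> A\<^sup>* \<Longrightarrow> (y, x) \<in> (A - {x} \<times> UNIV)\<^sup>*"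
proof (induction rule: converse_rtrancl_induct)
  case (step z z')
  show ?case
  proof (cases "z = x")
    case False
    then have "(z, z') \<in> A - {x} \<times> UNIV" using step by blast
    then show ?thesis using step.IH by (rule converse_rtrancl_into_rtrancl)
  qed blast
qed blast

abbreviation delete_vertex :: "'v rel \<Rightarrow> 'v \<Rightarrow> 'v rel" where
  "delete_vertex A x \<equiv> A - {x} \<times> UNIV - UNIV \<times> {x}"

text \<open>
  In the second case a path from \<open>z\<close> to \<open>r\<close> visits \<open>x\<close>, and is cut off
  there.
\<close>
lemma rtrancl_avoid_or_reach:
  "(z, r) \<in> A\<^sup>* \<Longrightarrow> (z, r) \<in> (delete_vertex A x)\<^sup>* \<or> (z, x) \<in> A\<^sup>*"
proof (induction rule: converse_rtrancl_induct)
  case (step a b)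
  show ?case
  proof (cases "(b, x) \<in> A\<^sup>* \<or> a = x")
    case True
    then have "(a, x) \<in> A\<^sup>*" using step(1) converse_rtrancl_into_rtrancl[of a b A x] by auto
    then show ?thesis ..
  next
    case False
    then have br: "(b, r) \<in> (delete_vertex A x)\<^sup>*" and "b \<noteq> x" using step.IH by auto
    have "(a, b) \<in> delete_vertex A x" using False \<open>b \<noteq> x\<close> step(1) by blast
    then show ?thesis using br by (rule converse_rtrancl_into_rtrancl[THEN disjI1])
  qed
qed blast

lemma in_forestsD:
  assumes "A \<in> in_forests V E R"
  shows "A \<subseteq> E" "single_valued A" "acyclic A" "Domain A = V - R"
  using assms by (auto simp: in_forests_def)

lemma finite_in_forests: "finite E \<Longrightarrow> finite (in_forests V E R)"
  by (rule finite_subset[of _ "Pow E"]) (auto simp: in_forests_def)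

lemma in_forests_root:
  assumes "finite E" "E \<subseteq> V \<times> V" "A \<in> in_forests V E R" "x \<in> V"
  shows "\<exists>r\<in>R. (x, r) \<in> A\<^sup>*"
proof -
  note A = in_forestsD[OF assms(3)]
  obtain r where r: "(x, r) \<in> A\<^sup>*" "r \<notin> Domain A"
    using ex_reachable_sink[of A x] A assms(1) by (auto dest: finite_subset)
  have "r \<in> V"
    using r(1) assms(4) by (induction rule: rtrancl_induct) (use A(1) assms(2) in auto)
  then show ?thesis using r A(4) by auto
qed

lemma in_forests_root_unique:
  assumes "A \<in> in_forests V E R" "r \<in> R" "s \<in> R" "(x, r) \<in> A\<^sup>*" "(x, s) \<in> A\<^sup>*"
  shows "r = s"
  using assms in_forestsD[OF assms(1)] by (intro reachable_sink_unique[of A x r s]) auto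

lemma in_forests_no_antiparallel:
  assumes "A \<in> in_forests V E R" "(x, y) \<in> A" shows "(y, x) \<notin> A"
proof
  assume "(y, x) \<in> A"
  then have "(x, x) \<in> A\<^sup>+" using assms(2) by auto
  then show False using in_forestsD(3)[OF assms(1)] by (auto simp: acyclic_def)
qed

subsection \<open>Cutting an out-arc\<close>

text \<open>
  A forest in which \<open>u\<close> is not a root is a forest \<open>B\<close> in which \<open>u\<close> is an
  additional root, together with an arc \<open>(u, x)\<close> that does not close a cycle. All identities
  between the weights of rooted forests and trees below come from this decomposition.
\<close>
lemma sum_in_forests_cut:
  fixes g :: "'v rel \<Rightarrow> 'b::comm_monoid_add"
  assumes "finite E" "u \<in> V" "u \<notin> R"
  shows "(\<Sum>A\<in>in_forests V E R. g A) =
    (\<Sum>B\<in>in_forests V E (insert u R). \<Sum>x | (u, x) \<in> E \<and> (x, u) \<notin> B\<^sup>*. g (insert (u, x) B))"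
proof -
  let ?X = "\<lambda>B. {x. (u, x) \<in> E \<and> (x, u) \<notin> B\<^sup>*}"
  have fin: "finite (?X B)" for B
    by (rule finite_subset[of _ "snd ` E"]) (use assms(1) in force)+
  have "(\<Sum>B\<in>in_forests V E (insert u R). \<Sum>x\<in>?X B. g (insert (u, x) B)) =
      (\<Sum>(B, x)\<in>Sigma (in_forests V E (insert u R)) ?X. g (insert (u, x) B))"
    using fin finite_in_forests[OF assms(1)] by (intro sum.Sigma) auto
  also have "\<dots> = (\<Sum>A\<in>in_forests V E R. g A)"
  proof (rule sum.reindex_bij_witness[where
        j = "\<lambda>(B, x). insert (u, x) B" and i = "\<lambda>A. (A - {u} \<times> UNIV, THE x. (u, x) \<in> A)"], goal_cases)
    case (1 a)
    then obtain B x where a: "a = (B, x)" and B: "B \<in> in_forests V E (insert u R)" by auto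
    have "u \<notin> Domain B" using in_forestsD(4)[OF B] by auto
    then show ?case unfolding a by (auto intro!: the_equality)
  next
    case (2 a)
    then obtain B x where a: "a = (B, x)" and B: "B \<in> in_forests V E (insert u R)"
      and x: "(u, x) \<in> E" "(x, u) \<notin> B\<^sup>*" by auto
    note B = in_forestsD[OF B]
    have "u \<notin> Domain B" using B(4) by auto
    then have "single_valued (insert (u, x) B)"
      using B(2) by (auto simp: single_valued_def)
    then show ?case
      using a B x assms by (auto simp: in_forests_def acyclic_insert)
  next
    case (3 A)
    note A = in_forestsD[OF 3]
    obtain x where x: "(u, x) \<in> A" using A(4) assms by blast
    have the: "(THE x. (u, x) \<in> A) = x" using x A(2) by (auto simp: single_valued_def)
    show ?case using x A(2) unfolding the by (auto simp: single_valued_def)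
  next
    case (4 A)
    note A = in_forestsD[OF 4]
    obtain x where x: "(u, x) \<in> A" using A(4) assms by blast
    have the: "(THE x. (u, x) \<in> A) = x" using x A(2) by (auto simp: single_valued_def)
    have ins: "A = insert (u, x) (A - {u} \<times> UNIV)" using x A(2) by (auto simp: single_valued_def)
    have "(x, u) \<notin> (A - {u} \<times> UNIV)\<^sup>*" "acyclic (A - {u} \<times> UNIV)"
      using A(3) acyclic_insert[of u x "A - {u} \<times> UNIV"] ins by metis+
    moreover have "single_valued (A - {u} \<times> UNIV)"
      using A(2) by (auto simp: single_valued_def)
    moreover have "Domain (A - {u} \<times> UNIV) = V - insert u R" using A(4) by auto
    ultimately show ?case unfolding the using A(1) x by (auto simp: in_forests_def)
  next
    case (5 a)
    then show ?case by auto
  qed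
  finally show ?thesis ..
qed

lemma rtrancl_insert_iff:
  "(y, r) \<in> (insert (u, x) B)\<^sup>* \<longleftrightarrow> (y, r) \<in> B\<^sup>* \<or> (y, u) \<in> B\<^sup>* \<and> (x, r) \<in> B\<^sup>*"
  by (auto simp: rtrancl_insert)

section \<open>Undirected forests and their orientations\<close>

text \<open>
  A graph without cycles is a graph in which every edge is a bridge. This form does not mention walks, and it is
  easy to use, since it suffices to connect the ends of an edge in another way.
\<close>
definition all_bridges :: "'v rel \<Rightarrow> bool" where
  "all_bridges B \<longleftrightarrow> (\<forall>a b. (a, b) \<in> B \<longrightarrow> (b, a) \<notin> (B - {(a, b), (b, a)})\<^sup>*)"

lemma all_bridgesD: "all_bridges B \<Longrightarrow> (a, b) \<in> B \<Longrightarrow> (b, a) \<notin> (B - {(a, b), (b, a)})\<^sup>*"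
  by (auto simp: all_bridges_def)

lemma sym_minus_edge: "sym B \<Longrightarrow> sym ((B - {(a, b), (b, a)})\<^sup>*)"
  by (rule sym_rtrancl) (auto simp: sym_def)

text \<open>
  If the edge of an arc \<open>(a, b)\<close> is deleted, then \<open>a\<close> becomes a root. If
  \<open>a\<close> and \<open>b\<close> were still connected, then \<open>b\<close> would have this root, so
  that \<open>(a, b)\<close> would close a directed cycle.
\<close>
lemma all_bridges_of_in_forest:
  assumes "single_valued A" "acyclic A"
  shows "all_bridges (A \<union> A\<inverse>)"
proof -
  have *: "(b, a) \<notin> (A \<union> A\<inverse> - {(a, b), (b, a)})\<^sup>*" if ab: "(a, b) \<in> A" for a b
  proof
    let ?A = "A - {(a, b)}"
    assume "(b, a) \<in> (A \<union> A\<inverse> - {(a, b), (b, a)})\<^sup>*"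
    then have "(b, a) \<in> (?A \<union> ?A\<inverse>)\<^sup>*"
      by (rule rtrancl_mono[THEN subsetD, rotated]) auto
    moreover have "single_valued ?A" using assms(1) by (auto simp: single_valued_def)
    ultimately obtain z where z: "(b, z) \<in> ?A\<^sup>*" "(a, z) \<in> ?A\<^sup>*"
      using single_valued_connected_imp_joinable by metis
    have "a \<notin> Domain ?A" using ab assms(1) by (auto simp: single_valued_def)
    then have "z = a" using z(2) by (rule rtrancl_from_sink[rotated])
    then have "(b, a) \<in> A\<^sup>*" using z(1) rtrancl_mono[of ?A A] by auto
    then have "(a, a) \<in> A\<^sup>+" using ab by auto
    then show False using assms(2) by (auto simp: acyclic_def)
  qed
  show ?thesis
    unfolding all_bridges_def
  proof (intro allI impI)
    fix a b assume "(a, b) \<in> A \<union> A\<inverse>"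
    then consider "(a, b) \<in> A" | "(b, a) \<in> A" by blast
    then show "(b, a) \<notin> (A \<union> A\<inverse> - {(a, b), (b, a)})\<^sup>*"
    proof cases
      case 1 then show ?thesis by (rule *)
    next
      case 2
      have "sym ((A \<union> A\<inverse> - {(a, b), (b, a)})\<^sup>*)"
        by (rule sym_minus_edge) (auto simp: sym_def)
      then show ?thesis using *[OF 2] by (metis insert_commute symD)
    qed
  qed
qed

text \<open>
  A directed cycle leaves \<open>x\<close> by an arc \<open>(x, y)\<close>, and its remaining part connects
  \<open>y\<close> to \<open>x\<close> without this edge, because the opposite arc is absent.
\<close>
lemma acyclic_if_all_bridges:
  assumes "all_bridges (A \<union> A\<inverse>)" "\<And>a b. (a, b) \<in> A \<Longrightarrow> (b, a) \<notin> A"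
  shows "acyclic A"
  unfolding acyclic_def
proof (intro allI notI)
  fix x assume "(x, x) \<in> A\<^sup>+"
  then obtain y where xy: "(x, y) \<in> A" and "(y, x) \<in> A\<^sup>*" by (meson tranclD)
  then have "(y, x) \<in> (A - {x} \<times> UNIV)\<^sup>*" by (simp add: rtrancl_without_leaving_target)
  then have "(y, x) \<in> (A \<union> A\<inverse> - {(x, y), (y, x)})\<^sup>*"
    by (rule rtrancl_mono[THEN subsetD, rotated]) (use assms(2)[OF xy] in auto)
  with assms(1) xy show False by (auto dest: all_bridgesD)
qed

text \<open>
  Otherwise \<open>a, c, \<dots>, r, \<dots>, b\<close> would be a connection of the ends of the edge \<open>{a,
  b}\<close> that does not use this edge: by acyclicity neither path to \<open>r\<close> returns to
  \<open>a\<close>.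
\<close>
lemma unique_out_arc_if_all_bridges:
  assumes "all_bridges (A \<union> A\<inverse>)" "acyclic A"
    and "(a, b) \<in> A" "(a, c) \<in> A" "(b, r) \<in> A\<^sup>*" "(c, r) \<in> A\<^sup>*"
  shows "b = c"
proof (rule ccontr)
  assume "b \<noteq> c"
  let ?B = "A \<union> A\<inverse> - {(a, b), (b, a)}"
  have not: "(z, a) \<notin> A\<^sup>*" if "(a, z) \<in> A" for z
  proof
    assume "(z, a) \<in> A\<^sup>*"
    then have "(a, a) \<in> A\<^sup>+" using that by auto
    then show False using assms(2) by (auto simp: acyclic_def)
  qed
  have "(b, a) \<notin> A" using not[OF assms(3)] by blast
  then have sub: "delete_vertex A a \<subseteq> ?B" by auto
  have "(b, r) \<in> (delete_vertex A a)\<^sup>*" "(c, r) \<in> (delete_vertex A a)\<^sup>*"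
    using rtrancl_avoid_or_reach[OF assms(5)] rtrancl_avoid_or_reach[OF assms(6)] not assms by blast+
  then have "(b, r) \<in> ?B\<^sup>*" "(c, r) \<in> ?B\<^sup>*" using rtrancl_mono[OF sub] by auto
  moreover have s: "sym (?B\<^sup>*)" by (rule sym_minus_edge) (auto simp: sym_def)
  ultimately have "(b, c) \<in> ?B\<^sup>*" by (meson rtrancl_trans symD)
  moreover have "(c, a) \<in> ?B" using assms(4) \<open>b \<noteq> c\<close> \<open>acyclic A\<close> not[OF assms(4)] by auto
  ultimately have "(b, a) \<in> ?B\<^sup>*" by (rule rtrancl_into_rtrancl)
  then show False using assms(1,3) by (auto dest: all_bridgesD)
qed

text \<open>
  The orientation of the edges towards \<open>R\<close>: an arc \<open>(x, y)\<close> is kept if, after deletion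
  of the edge \<open>{x, y}\<close>, its head is still connected to \<open>R\<close>.
\<close>
definition orient :: "'v rel \<Rightarrow> 'v set \<Rightarrow> 'v rel" where
  "orient B R = {(x, y) \<in> B. \<exists>r\<in>R. (y, r) \<in> (B - {(x, y), (y, x)})\<^sup>*}"

definition transversal :: "'v set \<Rightarrow> 'v rel \<Rightarrow> 'v set \<Rightarrow> bool" where
  "transversal V B R \<longleftrightarrow> R \<subseteq> V \<and> (\<forall>x\<in>V. \<exists>!r. r \<in> R \<and> (x, r) \<in> B\<^sup>*)"

text \<open>
  The undirected spanning forests in which every component contains exactly one element of \<open>R\<close>; an
  undirected edge is a pair of antiparallel arcs. With \<open>R\<close> as the set of roots, these are the
  forests that can be oriented to an element of \<open>in_forests V E R\<close>.
\<close>
definition edge_forests :: "'v set \<Rightarrow> 'v rel \<Rightarrow> 'v set \<Rightarrow> 'v rel set" where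
  "edge_forests V E R = {B. B \<subseteq> E \<and> sym B \<and> all_bridges B \<and> transversal V B R}"

text \<open>
  The witness \<open>y\<close> is the successor of the last visit to \<open>x\<close>.
\<close>
lemma last_exit:
  assumes "(z, r) \<in> B\<^sup>*" "r \<noteq> x"
  shows "(z, r) \<in> (delete_vertex B x)\<^sup>* \<or>
    (\<exists>y. (x, y) \<in> B \<and> (y, r) \<in> (delete_vertex B x)\<^sup>*)"
    (is "_ \<in> ?C\<^sup>* \<or> _")
  using assms(1)
proof (induction rule: converse_rtrancl_induct)
  case (step z z')
  show ?case
  proof (cases "\<exists>y. (x, y) \<in> B \<and> (y, r) \<in> ?C\<^sup>*")
    case False
    then have z': "(z', r) \<in> ?C\<^sup>*" using step.IH by blast
    have "z \<noteq> x" using False step(1) z' by blast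
    moreover have "z' \<noteq> x"
    proof
      assume "z' = x"
      then show False using z' assms(2) by (auto elim: converse_rtranclE)
    qed
    ultimately have "(z, z') \<in> ?C" using step(1) by blast
    then show ?thesis using z' by (blast intro: converse_rtrancl_into_rtrancl)
  qed blast
qed blast

lemma transversal_unique:
  assumes "transversal V B R" "x \<in> V" "r \<in> R" "s \<in> R" "(x, r) \<in> B\<^sup>*" "(x, s) \<in> B\<^sup>*"
  shows "r = s"
  using assms unfolding transversal_def by blast

context
  fixes V :: "'v set" and E B R
  assumes E: "E \<subseteq> V \<times> V" and B: "B \<in> edge_forests V E R"
begin

lemma edge_forest_facts:
  "B \<subseteq> E" "sym B" "all_bridges B" "transversal V B R"
  using B by (auto simp: edge_forests_def)

private lemma orientD:
  assumes "(x, y) \<in> orient B R"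
  obtains r where "(x, y) \<in> B" "r \<in> R" "(y, r) \<in> (B - {(x, y), (y, x)})\<^sup>*" "(y, r) \<in> B\<^sup>*" "(x, r) \<in> B\<^sup>*"
    "x \<in> V" "y \<in> V"
proof -
  from assms obtain r where r: "(x, y) \<in> B" "r \<in> R" "(y, r) \<in> (B - {(x, y), (y, x)})\<^sup>*"
    by (auto simp: orient_def)
  then have "(y, r) \<in> B\<^sup>*" using rtrancl_mono[of "B - {(x, y), (y, x)}" B] by auto
  moreover have "x \<in> V" "y \<in> V" using r(1) E edge_forest_facts(1) by auto
  ultimately show thesis using r that by (blast intro: converse_rtrancl_into_rtrancl)
qed

lemma orient_no_antiparallel:
  assumes "(x, y) \<in> orient B R" shows "(y, x) \<notin> orient B R"
proof
  assume "(y, x) \<in> orient B R"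
  then obtain s where s: "s \<in> R" "(x, s) \<in> (B - {(x, y), (y, x)})\<^sup>*" "(x, s) \<in> B\<^sup>*"
    by (auto elim!: orientD simp: insert_commute)
  from assms obtain r where r: "(x, y) \<in> B" "r \<in> R" "(y, r) \<in> (B - {(x, y), (y, x)})\<^sup>*" "(x, r) \<in> B\<^sup>*"
    "x \<in> V"
    by (rule orientD)
  have "r = s" using transversal_unique[OF edge_forest_facts(4)] r s by blast
  then have "(y, x) \<in> (B - {(x, y), (y, x)})\<^sup>*"
    using r s sym_minus_edge[OF edge_forest_facts(2)] by (meson rtrancl_trans symD)
  then show False using r(1) edge_forest_facts(3) by (auto dest: all_bridgesD)
qed

text \<open>
  Suppose that \<open>x\<close> had two out-arcs \<open>(x, y)\<close> and \<open>(x, z)\<close>. The path from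
  \<open>z\<close> to the root \<open>r\<close> of the component does not meet \<open>x\<close>, since
  \<open>{x, z}\<close> is a bridge; so \<open>x, z, \<dots>, r, \<dots>, y\<close> connects \<open>x\<close>
  and \<open>y\<close> without the edge \<open>{x, y}\<close>.
\<close>
lemma orient_single_valued: "single_valued (orient B R)"
  unfolding single_valued_def
proof (intro allI impI, rule ccontr)
  fix x y z assume xy: "(x, y) \<in> orient B R" and xz: "(x, z) \<in> orient B R" and "y \<noteq> z"
  from xy obtain r where r: "(x, y) \<in> B" "r \<in> R" "(y, r) \<in> (B - {(x, y), (y, x)})\<^sup>*" "(x, r) \<in> B\<^sup>*"
    "x \<in> V"
    by (rule orientD)
  from xz obtain s where s: "(x, z) \<in> B" "s \<in> R" "(z, s) \<in> (B - {(x, z), (z, x)})\<^sup>*" "(x, s) \<in> B\<^sup>*"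
    by (rule orientD)
  have [simp]: "s = r" using transversal_unique[OF edge_forest_facts(4)] r s by blast
  have nzx: "(z, x) \<notin> (B - {(x, z), (z, x)})\<^sup>*"
    using s(1) edge_forest_facts(3) by (auto dest: all_bridgesD)
  have "(z, r) \<in> (delete_vertex (B - {(x, z), (z, x)}) x)\<^sup>*"
    using rtrancl_avoid_or_reach[OF s(3), of x] nzx by simp
  then have "(z, r) \<in> (B - {(x, y), (y, x)})\<^sup>*"
    by (rule rtrancl_mono[THEN subsetD, rotated]) auto
  moreover have "(x, z) \<in> B - {(x, y), (y, x)}"
  proof -
    have "x \<noteq> y" using r(1) edge_forest_facts(3) by (auto simp: all_bridges_def)
    then show ?thesis using s(1) \<open>y \<noteq> z\<close> by auto
  qed
  ultimately have "(x, r) \<in> (B - {(x, y), (y, x)})\<^sup>*" by (rule converse_rtrancl_into_rtrancl[rotated])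
  then have "(y, x) \<in> (B - {(x, y), (y, x)})\<^sup>*"
    using r(3) sym_minus_edge[OF edge_forest_facts(2)] by (meson rtrancl_trans symD)
  then show False using r(1) edge_forest_facts(3) by (auto dest: all_bridgesD)
qed

text \<open>
  Every edge is oriented: on a path from the edge \<open>{x, y}\<close> to the root of its component, the part
  after the last use of that edge starts in \<open>x\<close> or in \<open>y\<close> and does not use the edge.
\<close>
lemma orient_symcl: "orient B R \<union> (orient B R)\<inverse> = B"
proof
  show "orient B R \<union> (orient B R)\<inverse> \<subseteq> B"
    using edge_forest_facts(2) by (auto simp: orient_def sym_def)
  show "B \<subseteq> orient B R \<union> (orient B R)\<inverse>"
  proof
    fix e assume "e \<in> B"
    then obtain x y where e: "e = (x, y)" and xy: "(x, y) \<in> B" by (cases e) auto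
    let ?C = "B - {(x, y), (y, x)}"
    have "x \<in> V" using xy E edge_forest_facts(1) by auto
    then obtain r where r: "r \<in> R" "(x, r) \<in> B\<^sup>*" using edge_forest_facts(4) by (auto simp: transversal_def)
    from r(2) have "(x, r) \<in> ?C\<^sup>* \<or> (y, r) \<in> ?C\<^sup>*"
    proof -
      have "(z, r) \<in> ?C\<^sup>* \<or> (x, r) \<in> ?C\<^sup>* \<or> (y, r) \<in> ?C\<^sup>*" if "(z, r) \<in> B\<^sup>*" for z
        using that
      proof (induction rule: converse_rtrancl_induct)
        case (step a b)
        show ?case
        proof (cases "(a, b) \<in> ?C")
          case True
          then show ?thesis using step.IH by (blast intro: converse_rtrancl_into_rtrancl)
        next
          case False
          then have "a = x \<and> b = y \<or> a = y \<and> b = x" using step(1) by blast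
          then show ?thesis using step.IH by blast
        qed
      qed blast
      then show ?thesis using r(2) by blast
    qed
    moreover have "(y, x) \<in> B" using symD[OF edge_forest_facts(2) xy] .
    ultimately show "e \<in> orient B R \<union> (orient B R)\<inverse>"
      using xy r(1) unfolding e orient_def by (auto simp: insert_commute)
  qed
qed

lemma orient_in_forests: "orient B R \<in> in_forests V E R"
proof -
  have "acyclic (orient B R)"
    using orient_no_antiparallel edge_forest_facts(3) by (intro acyclic_if_all_bridges) (auto simp: orient_symcl)
  moreover have "Domain (orient B R) = V - R"
  proof (intro equalityI subsetI)
    fix x assume "x \<in> Domain (orient B R)"
    then obtain y where "(x, y) \<in> orient B R" by blast
    then obtain r where r: "(x, y) \<in> B" "r \<in> R" "(y, r) \<in> (B - {(x, y), (y, x)})\<^sup>*" "(x, r) \<in> B\<^sup>*"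
      "x \<in> V"
      by (rule orientD)
    have "x \<notin> R"
    proof
      assume "x \<in> R"
      then have "x = r" using transversal_unique[OF edge_forest_facts(4), of x x r] r by blast
      then show False using r(1,3) edge_forest_facts(3) by (auto dest: all_bridgesD)
    qed
    then show "x \<in> V - R" using r by blast
  next
    fix x assume x: "x \<in> V - R"
    then obtain r where r: "r \<in> R" "(x, r) \<in> B\<^sup>*" using edge_forest_facts(4) by (auto simp: transversal_def)
    let ?C = "delete_vertex B x"
    have "r \<noteq> x" using x r by auto
    moreover have "(x, r) \<notin> ?C\<^sup>*" using \<open>r \<noteq> x\<close> by (auto elim: converse_rtranclE)
    ultimately obtain y where y: "(x, y) \<in> B" "(y, r) \<in> ?C\<^sup>*" using last_exit[OF r(2)] by blast
    then have "(y, r) \<in> (B - {(x, y), (y, x)})\<^sup>*"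
      using rtrancl_mono[of ?C "B - {(x, y), (y, x)}"] by auto
    then show "x \<in> Domain (orient B R)" using y(1) r(1) by (auto simp: orient_def)
  qed
  ultimately show ?thesis
    using orient_single_valued edge_forest_facts(1) by (auto simp: in_forests_def orient_def)
qed

end

text \<open>
  Together with \<open>orient_in_forests\<close> and \<open>orient_symcl\<close> this says that forgetting the
  directions is a bijection from \<open>in_forests V E R\<close> to \<open>edge_forests V E R\<close>. The
  inclusion \<open>A \<subseteq> orient (A \<union> A\<inverse>) R\<close> is an equality, because an
  orientation has no antiparallel arcs.
\<close>
lemma symcl_in_forest:
  assumes "finite E" "E \<subseteq> V \<times> V" "sym E" "R \<subseteq> V" "A \<in> in_forests V E R"
  shows "A \<union> A\<inverse> \<in> edge_forests V E R" "orient (A \<union> A\<inverse>) R = A"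
proof -
  note A = in_forestsD[OF assms(5)]
  let ?B = "A \<union> A\<inverse>"
  have "\<exists>!r. r \<in> R \<and> (x, r) \<in> ?B\<^sup>*" if "x \<in> V" for x
  proof -
    obtain r where r: "r \<in> R" "(x, r) \<in> A\<^sup>*" using in_forests_root[OF assms(1,2,5) \<open>x \<in> V\<close>] by blast
    show ?thesis
    proof (rule ex1I[of _ r])
      show "r \<in> R \<and> (x, r) \<in> ?B\<^sup>*" using r rtrancl_mono[of A ?B] by auto
      fix s assume s: "s \<in> R \<and> (x, s) \<in> ?B\<^sup>*"
      then obtain z where z: "(x, z) \<in> A\<^sup>*" "(s, z) \<in> A\<^sup>*"
        using single_valued_connected_imp_joinable[OF A(2)] by blast
      have "z = s" using z(2) rtrancl_from_sink[of s z A] A(4) s by auto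
      then show "s = r" using in_forests_root_unique[OF assms(5), of s r x] s r z by auto
    qed
  qed
  then show B: "?B \<in> edge_forests V E R"
    using A assms all_bridges_of_in_forest[of A]
    by (auto simp: edge_forests_def transversal_def sym_def)
  have sub: "A \<subseteq> orient ?B R"
  proof
    fix e assume "e \<in> A"
    then obtain x y where e: "e = (x, y)" and xy: "(x, y) \<in> A" by (cases e) auto
    then have "y \<in> V" using A(1) assms(2) by auto
    then obtain r where r: "r \<in> R" "(y, r) \<in> A\<^sup>*" using in_forests_root[OF assms(1,2,5)] by blast
    have "(y, x) \<notin> A\<^sup>*" using xy A(3) by (auto simp: acyclic_def dest: rtrancl_into_trancl2)
    then have "(y, r) \<in> (delete_vertex A x)\<^sup>*" using rtrancl_avoid_or_reach[OF r(2), of x] by blast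
    moreover have "delete_vertex A x \<subseteq> ?B - {(x, y), (y, x)}"
      using in_forests_no_antiparallel[OF assms(5) xy] by auto
    ultimately have "(y, r) \<in> (?B - {(x, y), (y, x)})\<^sup>*" using rtrancl_mono by blast
    then show "e \<in> orient ?B R" using e xy r(1) by (auto simp: orient_def)
  qed
  have "orient ?B R \<subseteq> A"
  proof
    fix e assume e: "e \<in> orient ?B R"
    obtain x y where [simp]: "e = (x, y)" by (cases e)
    have "(x, y) \<in> A \<or> (y, x) \<in> A" using e by (auto simp: orient_def)
    moreover have "(y, x) \<notin> A" using orient_no_antiparallel[OF assms(2) B, of x y] e sub by auto
    ultimately show "e \<in> A" by simp
  qed
  then show "orient ?B R = A" using sub by blast
qed

section \<open>The linear system for separating 2-forests\<close>

locale weighted_arcs =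
  fixes V :: "'v set" and E :: "'v rel" and \<omega> :: "'v \<times> 'v \<Rightarrow> real"
  assumes finite_V: "finite V" and E_sub: "E \<subseteq> V \<times> V"
    and zero: "e \<notin> E \<Longrightarrow> \<omega> e = 0"
begin

lemma finite_E: "finite E"
  using E_sub finite_V by (auto intro: finite_subset)

text \<open>
  This is \<open>\<tau>\<^sub>v\<close>.
\<close>
definition tree_sum :: "'v \<Rightarrow> real" where
  "tree_sum v = (\<Sum>A\<in>in_forests V E {v}. prod \<omega> A)"

text \<open>
  The linear system below is one for functions of \<open>x\<close>, with \<open>v\<close> and \<open>r\<close>
  fixed. For this reason the condition that \<open>x\<close> belongs to the tree of \<open>r\<close> is a factor
  of the summand instead of a restriction of the index set.
\<close>
definition sep_sum :: "'v \<Rightarrow> 'v \<Rightarrow> 'v \<Rightarrow> real" where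
  "sep_sum v r x = (\<Sum>A\<in>in_forests V E {v, r}. prod \<omega> A * of_bool ((x, r) \<in> A\<^sup>*))"

text \<open>
  The weighted form of the cut at \<open>u\<close>. As \<open>\<omega>\<close> vanishes outside
  \<open>E\<close>, the inner sum may run over all vertices.
\<close>
lemma weighted_cut:
  assumes "u \<in> V" "u \<notin> R"
  shows "(\<Sum>A\<in>in_forests V E R. prod \<omega> A * g A) =
    (\<Sum>B\<in>in_forests V E (insert u R).
       prod \<omega> B * (\<Sum>x | x \<in> V \<and> (x, u) \<notin> B\<^sup>*. \<omega> (u, x) * g (insert (u, x) B)))"
proof -
  have "(\<Sum>x | (u, x) \<in> E \<and> (x, u) \<notin> B\<^sup>*. prod \<omega> (insert (u, x) B) * g (insert (u, x) B)) =
      prod \<omega> B * (\<Sum>x | x \<in> V \<and> (x, u) \<notin> B\<^sup>*. \<omega> (u, x) * g (insert (u, x) B))"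
    if B: "B \<in> in_forests V E (insert u R)" for B
  proof -
    have "finite B" using in_forestsD(1)[OF B] finite_E by (rule finite_subset)
    moreover have "(u, x) \<notin> B" for x using in_forestsD(4)[OF B] by blast
    ultimately have p: "prod \<omega> (insert (u, x) B) = prod \<omega> B * \<omega> (u, x)" for x by simp
    show ?thesis
      unfolding sum_distrib_left p mult.assoc
      by (rule sum.mono_neutral_left) (use finite_V E_sub zero in auto)
  qed
  then show ?thesis
    by (subst sum_in_forests_cut[OF finite_E assms]) (rule sum.cong[OF refl])
qed

text \<open>
  The function \<open>sep_sum v r\<close> is harmonic outside \<open>v\<close> and \<open>r\<close>. Cutting the
  out-arc \<open>(u, x)\<close> of \<open>u\<close> leaves a forest \<open>B\<close> with roots
  \<open>u\<close>, \<open>v\<close>, \<open>r\<close>. For fixed \<open>B\<close>, the contribution of the pair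
  \<open>(x, w)\<close> to the sum is \<open>\<omega> (u, x) * \<omega> (u, w)\<close> times the difference of
  the indicators that \<open>x\<close> and that \<open>w\<close> belongs to the tree of \<open>r\<close>, if
  neither vertex belongs to the tree of \<open>u\<close>. This is antisymmetric in \<open>x\<close> and
  \<open>w\<close>. If \<open>w\<close> belongs to the tree of \<open>u\<close>, then \<open>u\<close> and
  \<open>w\<close> have the same root in the uncut forest and the contribution is zero.
\<close>
lemma sep_sum_balance:
  assumes "u \<in> V" "u \<noteq> v" "u \<noteq> r"
  shows "(\<Sum>w\<in>V. \<omega> (u, w) * (sep_sum v r u - sep_sum v r w)) = 0"
proof -
  let ?F = "in_forests V E {u, v, r}"
  \<comment> \<open>Vertices that may be the head of the arc at \<open>u\<close>.\<close>
  define N where "N B = {x \<in> V. (x, u) \<notin> B\<^sup>*}" for B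
  \<comment> \<open>Whether \<open>w\<close> belongs to the tree of \<open>r\<close> after the arc \<open>(u, x)\<close> has been added to \<open>B\<close>.\<close>
  define c where "c B w x = (of_bool ((w, r) \<in> B\<^sup>* \<or> (w, u) \<in> B\<^sup>* \<and> (x, r) \<in> B\<^sup>*) :: real)" for B w x
  have fin: "finite (N B)" for B using finite_V by (simp add: N_def)
  have sep: "sep_sum v r w = (\<Sum>B\<in>?F. prod \<omega> B * (\<Sum>x\<in>N B. \<omega> (u, x) * c B w x))" for w
    using assms unfolding sep_sum_def N_def c_def
    by (subst weighted_cut[of u]) (auto simp: rtrancl_insert_iff insert_commute)
  have "(\<Sum>w\<in>V. \<omega> (u, w) * (sep_sum v r u - sep_sum v r w)) =
      (\<Sum>B\<in>?F. prod \<omega> B * (\<Sum>w\<in>V. \<omega> (u, w) * (\<Sum>x\<in>N B. \<omega> (u, x) * (c B u x - c B w x))))"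
  proof -
    have "\<omega> (u, w) * (sep_sum v r u - sep_sum v r w) =
        (\<Sum>B\<in>?F. prod \<omega> B * (\<omega> (u, w) * (\<Sum>x\<in>N B. \<omega> (u, x) * (c B u x - c B w x))))" for w
      unfolding sep
      by (simp add: sum_subtractf[symmetric] right_diff_distrib sum_distrib_left mult_ac)
    then show ?thesis
      by (simp only: sum_distrib_left[where r = "prod \<omega> _"]) (rule sum.swap)
  qed
  also have "\<dots> = (\<Sum>B\<in>?F. prod \<omega> B * 0)"
  proof (intro sum.cong refl arg_cong2[of _ _ _ _ "(*)"])
    fix B assume B: "B \<in> ?F"
    have ur: "(u, r) \<notin> B\<^sup>*"
      using rtrancl_from_sink[of u r B] in_forestsD(4)[OF B] assms by auto
    have disj: "\<not> ((x, u) \<in> B\<^sup>* \<and> (x, r) \<in> B\<^sup>*)" for x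
      using in_forests_root_unique[OF B, of u r x] assms by auto
    define b where "b x = (of_bool ((x, r) \<in> B\<^sup>*) :: real)" for x
    have "(\<Sum>w\<in>V. \<omega> (u, w) * (\<Sum>x\<in>N B. \<omega> (u, x) * (c B u x - c B w x))) =
      (\<Sum>w\<in>N B. \<omega> (u, w) * (\<Sum>x\<in>N B. \<omega> (u, x) * (c B u x - c B w x)))"
      using finite_V ur disj by (intro sum.mono_neutral_right) (auto simp: N_def c_def)
    also have "\<dots> = (\<Sum>w\<in>N B. \<Sum>x\<in>N B. \<omega> (u, w) * \<omega> (u, x) * b x - \<omega> (u, w) * \<omega> (u, x) * b w)"
      unfolding sum_distrib_left
      by (intro sum.cong refl) (use ur in \<open>auto simp: N_def c_def b_def algebra_simps\<close>)
    also have "\<dots> = 0"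
      by (simp add: sum_subtractf) (subst sum.swap, simp add: mult_ac)
    finally show "(\<Sum>w\<in>V. \<omega> (u, w) * (\<Sum>x\<in>N B. \<omega> (u, x) * (c B u x - c B w x))) = 0" .
  qed
  finally show ?thesis by simp
qed

text \<open>
  The difference \<open>sep_sum v u u - sep_sum v u w\<close> is the weight of the forests with roots
  \<open>u\<close>, \<open>v\<close> in which \<open>w\<close> belongs to the tree of \<open>v\<close>. Adding
  the arc \<open>(u, w)\<close> yields every spanning tree with root \<open>v\<close> once.
\<close>
lemma sep_sum_at_root:
  assumes "u \<in> V" "u \<noteq> v"
  shows "(\<Sum>w\<in>V. \<omega> (u, w) * (sep_sum v u u - sep_sum v u w)) = tree_sum v"
proof -
  let ?F = "in_forests V E {u, v}"
  have F: "in_forests V E {v, u} = ?F" by (simp add: insert_commute)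
  have "tree_sum v = (\<Sum>B\<in>?F. prod \<omega> B * (\<Sum>x | x \<in> V \<and> (x, u) \<notin> B\<^sup>*. \<omega> (u, x)))"
    unfolding tree_sum_def using weighted_cut[of u "{v}" "\<lambda>_. 1"] assms by simp
  also have "\<dots> = (\<Sum>B\<in>?F. prod \<omega> B * (\<Sum>x\<in>V. \<omega> (u, x) * (1 - of_bool ((x, u) \<in> B\<^sup>*))))"
    using finite_V by (intro sum.cong refl arg_cong2[of _ _ _ _ "(*)"] sum.mono_neutral_cong_left) auto
  also have "\<dots> = (\<Sum>x\<in>V. \<omega> (u, x) * (\<Sum>B\<in>?F. prod \<omega> B * (1 - of_bool ((x, u) \<in> B\<^sup>*))))"
    unfolding sum_distrib_left by (subst sum.swap) (simp add: mult_ac)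
  also have "\<dots> = (\<Sum>w\<in>V. \<omega> (u, w) * (sep_sum v u u - sep_sum v u w))"
    unfolding sep_sum_def F by (simp add: sum_subtractf right_diff_distrib)
  finally show ?thesis ..
qed

lemma sep_sum_target: "r \<in> V \<Longrightarrow> r \<noteq> v \<Longrightarrow> sep_sum v r v = 0"
  unfolding sep_sum_def
proof (rule sum.neutral, intro ballI)
  fix A assume r: "r \<in> V" "r \<noteq> v" and A: "A \<in> in_forests V E {v, r}"
  have "(v, r) \<notin> A\<^sup>*"
    using rtrancl_from_sink[of v r A] in_forestsD(4)[OF A] r by auto
  then show "prod \<omega> A * of_bool ((v, r) \<in> A\<^sup>*) = 0" by simp
qed

text \<open>
  Up to the factor \<open>\<tau>\<^sub>v\<close>, this is the first-step equation of the hitting times when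
  \<open>d\<close> is the degree: the summands with \<open>r \<noteq> u\<close> satisfy the homogeneous
  equation, and \<open>r = u\<close> contributes the inhomogeneous term.
\<close>
lemma sep_sum_system:
  fixes d :: "'v \<Rightarrow> real"
  assumes "u \<in> V" "u \<noteq> v"
  defines "S \<equiv> \<lambda>x. \<Sum>r\<in>V - {v}. d r * sep_sum v r x"
  shows "(\<Sum>w\<in>V. \<omega> (u, w)) * S u = d u * tree_sum v + (\<Sum>w\<in>V. \<omega> (u, w) * S w)"
proof -
  have "(\<Sum>w\<in>V. \<omega> (u, w)) * S u - (\<Sum>w\<in>V. \<omega> (u, w) * S w) = (\<Sum>w\<in>V. \<omega> (u, w) * (S u - S w))"
    by (simp add: sum_distrib_right sum_subtractf right_diff_distrib)
  also have "\<dots> = (\<Sum>w\<in>V. \<Sum>r\<in>V - {v}. d r * (\<omega> (u, w) * (sep_sum v r u - sep_sum v r w)))"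
    unfolding S_def sum_subtractf[symmetric] sum_distrib_left
    by (intro sum.cong refl) (simp add: algebra_simps)
  also have "\<dots> = (\<Sum>r\<in>V - {v}. d r * (\<Sum>w\<in>V. \<omega> (u, w) * (sep_sum v r u - sep_sum v r w)))"
    unfolding sum_distrib_left by (rule sum.swap)
  also have "\<dots> = (\<Sum>r\<in>V - {v}. if r = u then d u * tree_sum v else 0)"
    using assms(1,2) by (intro sum.cong refl) (auto simp: sep_sum_balance sep_sum_at_root)
  also have "\<dots> = d u * tree_sum v"
    using assms(1,2) finite_V by simp
  finally show ?thesis by simp
qed

text \<open>
  Every vertex chooses an arc to a vertex that is closer to \<open>v\<close>.
\<close>
lemma ex_spanning_in_tree:
  assumes "\<And>x. x \<in> V \<Longrightarrow> (x, v) \<in> E\<^sup>*"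
  shows "in_forests V E {v} \<noteq> {}"
proof -
  define dst where "dst x = (LEAST n. (x, v) \<in> E ^^ n)" for x
  have dst: "(x, v) \<in> E ^^ dst x" if x: "x \<in> V" for x
  proof -
    obtain n where "(x, v) \<in> E ^^ n" using rtrancl_imp_relpow[OF assms[OF x]] by blast
    then show ?thesis unfolding dst_def by (rule LeastI)
  qed
  have "\<exists>y. (x, y) \<in> E \<and> dst y < dst x" if x: "x \<in> V - {v}" for x
  proof -
    have "dst x \<noteq> 0" using dst[of x] x by (cases "dst x") auto
    then obtain m where m: "dst x = Suc m" by (cases "dst x") auto
    with dst[of x] x have "(x, v) \<in> E ^^ Suc m" by auto
    from relpow_Suc_D2[OF this] obtain y where y: "(x, y) \<in> E" "(y, v) \<in> E ^^ m" by blast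
    then have "dst y \<le> m" unfolding dst_def by (intro Least_le)
    then show ?thesis using y m by auto
  qed
  then obtain f where f: "\<And>x. x \<in> V - {v} \<Longrightarrow> (x, f x) \<in> E \<and> dst (f x) < dst x" by metis
  let ?A = "{(x, f x) | x. x \<in> V - {v}}"
  have "?A\<inverse> \<subseteq> Wellfounded.measure dst" using f by auto
  then have "acyclic (?A\<inverse>)" using wf_acyclic[OF wf_measure] acyclic_subset by blast
  then have "?A \<in> in_forests V E {v}"
    using f by (auto simp: in_forests_def single_valued_def acyclic_converse)
  then show ?thesis by blast
qed

lemma tree_sum_pos:
  assumes "\<And>x. x \<in> V \<Longrightarrow> (x, v) \<in> E\<^sup>*" "\<And>e. e \<in> E \<Longrightarrow> 0 < \<omega> e"
  shows "0 < tree_sum v"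
  unfolding tree_sum_def
proof (rule sum_pos)
  show "finite (in_forests V E {v})" using finite_E by (rule finite_in_forests)
  show "in_forests V E {v} \<noteq> {}" using assms(1) by (rule ex_spanning_in_tree)
  show "0 < prod \<omega> A" if "A \<in> in_forests V E {v}" for A
    using in_forestsD(1)[OF that] assms(2) by (auto intro!: prod_pos)
qed

text \<open>
  Cut the out-arc of \<open>v\<close>: a tree with root \<open>r\<close> contains \<open>(v, u)\<close> if and
  only if this is the arc that is cut, and then \<open>u\<close> belongs to the tree of \<open>r\<close> because
  \<open>(v, u)\<close> does not close a cycle.
\<close>
lemma trees_with_arc_eq_sep_sum:
  assumes "(v, u) \<in> E" "r \<in> V" "r \<noteq> v"
  shows "(\<Sum>A | A \<in> in_forests V E {r} \<and> (v, u) \<in> A. prod \<omega> A) = \<omega> (v, u) * sep_sum v r u"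
proof -
  have v: "v \<in> V" "u \<in> V" using assms E_sub by auto
  have "(\<Sum>A | A \<in> in_forests V E {r} \<and> (v, u) \<in> A. prod \<omega> A) =
      (\<Sum>A\<in>in_forests V E {r}. prod \<omega> A * of_bool ((v, u) \<in> A))"
    by (rule sum.mono_neutral_cong_left) (use finite_in_forests[OF finite_E] in auto)
  also have "\<dots> = (\<Sum>B\<in>in_forests V E {v, r}.
      prod \<omega> B * (\<Sum>x | x \<in> V \<and> (x, v) \<notin> B\<^sup>*. \<omega> (v, x) * of_bool ((v, u) \<in> insert (v, x) B)))"
    using assms v by (subst weighted_cut[of v]) auto
  also have "\<dots> = (\<Sum>B\<in>in_forests V E {v, r}. prod \<omega> B * (\<omega> (v, u) * of_bool ((u, r) \<in> B\<^sup>*)))"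
  proof (intro sum.cong refl arg_cong2[of _ _ _ _ "(*)"])
    fix B assume B: "B \<in> in_forests V E {v, r}"
    have "(v, u) \<notin> B" using in_forestsD(4)[OF B] by blast
    then have "(\<Sum>x | x \<in> V \<and> (x, v) \<notin> B\<^sup>*. \<omega> (v, x) * of_bool ((v, u) \<in> insert (v, x) B)) =
        (\<Sum>x | x \<in> V \<and> (x, v) \<notin> B\<^sup>*. if x = u then \<omega> (v, u) else 0)"
      by (intro sum.cong) auto
    also have "\<dots> = \<omega> (v, u) * of_bool ((u, v) \<notin> B\<^sup>*)"
      using finite_V v by auto
    also have "(u, v) \<notin> B\<^sup>* \<longleftrightarrow> (u, r) \<in> B\<^sup>*"
      using in_forests_root[OF finite_E E_sub B v(2)] in_forests_root_unique[OF B, of v r u] assms(3)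
      by auto
    finally show "(\<Sum>x | x \<in> V \<and> (x, v) \<notin> B\<^sup>*. \<omega> (v, x) * of_bool ((v, u) \<in> insert (v, x) B)) =
      \<omega> (v, u) * of_bool ((u, r) \<in> B\<^sup>*)" .
  qed
  also have "\<dots> = \<omega> (v, u) * sep_sum v r u"
    by (simp add: sep_sum_def sum_distrib_left mult_ac)
  finally show ?thesis .
qed

end

section \<open>Components, cycles and roots of digraphs in terms of arcs\<close>

abbreviation digraph_on :: "'v set \<Rightarrow> 'v rel \<Rightarrow> 'v pair_pre_digraph" where
  "digraph_on V A \<equiv> \<lparr>pverts = V, parcs = A\<rparr>"

definition comp_of :: "'v set \<Rightarrow> 'v rel \<Rightarrow> 'v \<Rightarrow> 'v set" where
  "comp_of V A x = {y \<in> V. (x, y) \<in> (A \<union> A\<inverse>)\<^sup>*}"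

lemma pair_wf_digraph_digraph_on: "B \<subseteq> V \<times> V \<Longrightarrow> pair_wf_digraph (digraph_on V B)"
  by unfold_locales auto

lemma rtrancl_in_verts: "(x, y) \<in> B\<^sup>* \<Longrightarrow> B \<subseteq> V \<times> V \<Longrightarrow> x \<in> V \<Longrightarrow> y \<in> V"
  by (induction rule: rtrancl_induct) auto

lemma reachable_digraph_on:
  assumes "B \<subseteq> V \<times> V"
  shows "reachable (with_proj (digraph_on V B)) x y \<longleftrightarrow> x \<in> V \<and> (x, y) \<in> B\<^sup>*"
proof
  assume "reachable (with_proj (digraph_on V B)) x y"
  then show "x \<in> V \<and> (x, y) \<in> B\<^sup>*"
    using reachable_rtranclI[of "with_proj (digraph_on V B)" x y]
    by (auto elim: reachable_in_vertsE)
next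
  assume "x \<in> V \<and> (x, y) \<in> B\<^sup>*"
  then show "reachable (with_proj (digraph_on V B)) x y"
    using assms rtrancl_in_verts[OF _ assms, of x y]
    by (auto simp: reachable_def intro!: rtrancl_consistent_rtrancl_on)
qed

lemma ex_apath_digraph_on:
  assumes "B \<subseteq> V \<times> V"
  shows "(\<exists>p. pre_digraph.apath (with_proj (digraph_on V B)) x p y) \<longleftrightarrow> x \<in> V \<and> (x, y) \<in> B\<^sup>*"
proof -
  interpret pair_wf_digraph "digraph_on V B" using assms by (rule pair_wf_digraph_digraph_on)
  show ?thesis using reachable_apath reachable_digraph_on[OF assms] by blast
qed

lemma mk_symmetric_digraph_on: "mk_symmetric (with_proj (digraph_on V A)) = digraph_on V (A \<union> A\<inverse>)"
  by (auto simp: mk_symmetric_def)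

lemma weak_components_digraph_on:
  assumes "A \<subseteq> V \<times> V"
  shows "weak_components (digraph_on V A) = comp_of V A ` V"
proof -
  let ?B = "A \<union> A\<inverse>"
  have B: "?B \<subseteq> V \<times> V" using assms by auto
  have s: "sym (?B\<^sup>*)" by (rule sym_rtrancl) (auto simp: sym_def)
  have "S \<in> weak_components (digraph_on V A) \<longleftrightarrow> S \<in> comp_of V A ` V" (is "?l \<longleftrightarrow> ?r") for S
  proof -
    have l: "?l \<longleftrightarrow> S \<noteq> {} \<and> (\<forall>x\<in>S. \<forall>y\<in>S. x \<in> V \<and> (x, y) \<in> ?B\<^sup>*) \<and>
        (\<forall>x\<in>S. \<forall>y. y \<notin> S \<longrightarrow> \<not> (x \<in> V \<and> (x, y) \<in> ?B\<^sup>*) \<or> \<not> (y \<in> V \<and> (y, x) \<in> ?B\<^sup>*))"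
      by (simp only: weak_components_def mk_symmetric_digraph_on pre_digraph.sccs_verts_def
        reachable_digraph_on[OF B] mem_Collect_eq)
    show ?thesis
    proof
      assume ?l
      note S = this[unfolded l]
      then obtain x where x: "x \<in> S" by blast
      have "y \<in> S \<longleftrightarrow> y \<in> V \<and> (x, y) \<in> ?B\<^sup>*" for y
        using S x symD[OF s, of x y] by blast
      then have "S = comp_of V A x" by (auto simp: comp_of_def)
      then show ?r using x S by blast
    next
      assume ?r
      then obtain x where x: "x \<in> V" and S: "S = comp_of V A x" by blast
      have "(y, z) \<in> ?B\<^sup>*" if "y \<in> S" "z \<in> S" for y z
        using that symD[OF s, of x y] by (auto simp: S comp_of_def intro: rtrancl_trans)
      moreover have "z \<in> S" if "y \<in> S" "(y, z) \<in> ?B\<^sup>*" "z \<in> V" for y z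
        using that by (auto simp: S comp_of_def intro: rtrancl_trans)
      moreover have "S \<subseteq> V" by (auto simp: S comp_of_def)
      moreover have "x \<in> S" using x by (simp add: S comp_of_def)
      ultimately show ?l unfolding l by blast
    qed
  qed
  then show ?thesis by blast
qed

subsection \<open>Cycles and bridges\<close>

text \<open>
  Used for the rest of a cycle after one of its vertices, which gives a path that avoids this vertex and hence
  the edges at it.
\<close>
lemma apath_avoids_vertex:
  assumes "B \<subseteq> V \<times> V" "pre_digraph.apath (with_proj (digraph_on V B)) c p a"
    and "x \<notin> set (pawalk_verts c p)"
  shows "(c, a) \<in> (delete_vertex B x)\<^sup>*"
proof -
  interpret pair_wf_digraph "digraph_on V B" using assms(1) by (rule pair_wf_digraph_digraph_on)
  show ?thesis
    using assms(2,3)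
  proof (induction p arbitrary: c)
    case Nil
    then show ?case by (simp add: apath_Nil_iff)
  next
    case (Cons e p)
    obtain d where e: "e = (c, d)" using Cons.prems by (cases e) (auto simp: apath_Cons_iff)
    then have d: "(c, d) \<in> B" "apath d p a" using Cons.prems by (auto simp: apath_Cons_iff)
    have "d \<in> set (pawalk_verts d p)" by (cases p) (use d(2) in \<open>auto simp: apath_Cons_iff\<close>)
    then have "x \<noteq> c" "x \<noteq> d" using Cons.prems(2) e by auto
    then have "(c, d) \<in> delete_vertex B x" using d(1) by blast
    moreover have "(d, a) \<in> (delete_vertex B x)\<^sup>*" using Cons.IH[OF d(2)] Cons.prems(2) e by simp
    ultimately show ?case by (rule converse_rtrancl_into_rtrancl)
  qed
qed

text \<open>
  The first arc \<open>(a, b)\<close> of a cycle of length at least 3 is not a bridge, as the rest of the cycle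
  is a path from \<open>b\<close> to \<open>a\<close>. Conversely a path from \<open>b\<close> to
  \<open>a\<close> without this edge closes with \<open>(a, b)\<close> to a cycle; its length is at least 3,
  since the only shorter candidates are a loop and \<open>a, b, a\<close>.
\<close>
lemma no_long_cycle_iff_all_bridges:
  assumes B: "B \<subseteq> V \<times> V" and irrefl: "\<And>a. (a, a) \<notin> B"
  shows "\<not> (\<exists>p. pre_digraph.cycle (with_proj (digraph_on V B)) p \<and> 3 \<le> length p) \<longleftrightarrow> all_bridges B"
proof -
  interpret B: pair_wf_digraph "digraph_on V B" using B by (rule pair_wf_digraph_digraph_on)
  have "\<not> all_bridges B" if "B.cycle p" "3 \<le> length p" for p
  proof -
    from that(2) obtain e f p' where p: "p = e # f # p'" "p' \<noteq> []"
      by (cases p; cases "tl p"; cases "tl (tl p)") auto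
    obtain a b where e: "e = (a, b)" by (cases e)
    from that(1) have ab: "(a, b) \<in> B" and path: "B.apath b (f # p') a"
      by (auto simp: B.cycle_def p e B.awalk_Cons_iff B.apath_def)
    then obtain c where f: "f = (b, c)" by (cases f) (auto simp: B.apath_Cons_iff)
    have bc: "(b, c) \<in> B" and path': "B.apath c p' a" "b \<notin> set (pawalk_verts c p')"
      using path by (auto simp: f B.apath_Cons_iff)
    have "a \<noteq> b" "c \<noteq> a"
      using irrefl ab B.apath_nonempty_ends[OF path'(1) p(2)] by auto
    then have "(b, c) \<in> B - {(a, b), (b, a)}" using bc by auto
    moreover have "(c, a) \<in> (B - {(a, b), (b, a)})\<^sup>*"
      using apath_avoids_vertex[OF B path'] by (rule rtrancl_mono[THEN subsetD, rotated]) auto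
    ultimately have "(b, a) \<in> (B - {(a, b), (b, a)})\<^sup>*" by (rule converse_rtrancl_into_rtrancl)
    then show ?thesis using ab by (auto simp: all_bridges_def)
  qed
  moreover have "\<exists>p. B.cycle p \<and> 3 \<le> length p" if "\<not> all_bridges B"
  proof -
    obtain a b where ab: "(a, b) \<in> B" and "(b, a) \<in> (B - {(a, b), (b, a)})\<^sup>*" (is "_ \<in> ?C\<^sup>*")
      using \<open>\<not> all_bridges B\<close> by (auto simp: all_bridges_def)
    moreover have C: "?C \<subseteq> V \<times> V" using B by auto
    moreover have "b \<in> V" using ab B by auto
    ultimately obtain p where p: "pre_digraph.apath (with_proj (digraph_on V ?C)) b p a"
      using ex_apath_digraph_on[of ?C V b a] by blast
    interpret C: pair_wf_digraph "digraph_on V ?C" using C by (rule pair_wf_digraph_digraph_on)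
    have "set p \<subseteq> ?C" using p by (auto simp: C.apath_def C.awalk_def)
    then have "B.awalk b p a" "distinct (pawalk_verts b p)"
      using p by (auto simp: C.apath_def C.awalk_def B.awalk_def)
    then have "B.cycle ((a, b) # p)"
      using ab by (auto simp: B.cycle_def B.awalk_Cons_iff)
    moreover have "2 \<le> length p"
    proof (rule ccontr)
      assume "\<not> 2 \<le> length p"
      then consider "p = []" | e where "p = [e]" by (cases p; cases "tl p") auto
      then show False
      proof cases
        case 1
        then show False using p irrefl ab by (auto simp: C.apath_Nil_iff)
      next
        case 2
        then have "e = (b, a)" using p by (cases e) (auto simp: C.apath_Nil_iff C.apath_Cons_iff)
        then show False using 2 \<open>set p \<subseteq> ?C\<close> by auto
      qed
    qed
    ultimately show ?thesis by (intro exI[of _ "(a, b) # p"]) auto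
  qed
  ultimately show ?thesis by blast
qed

subsection \<open>Rooted forests\<close>

text \<open>
  The weak components of a rooted forest are the trees: paths from connected vertices can be prolonged until
  they meet, and a path that has reached a root cannot be prolonged.
\<close>
lemma comp_of_in_forest:
  assumes "finite E" "E \<subseteq> V \<times> V" "A \<in> in_forests V E R" "R \<subseteq> V" "r \<in> R" "(x, r) \<in> A\<^sup>*" "x \<in> V"
  shows "comp_of V A x = {y \<in> V. (y, r) \<in> A\<^sup>*}"
proof -
  note A = in_forestsD[OF assms(3)]
  have sub: "A\<^sup>* \<subseteq> (A \<union> A\<inverse>)\<^sup>*" by (rule rtrancl_mono) auto
  have s: "sym ((A \<union> A\<inverse>)\<^sup>*)" by (rule sym_rtrancl) (auto simp: sym_def)
  have xr: "(x, r) \<in> (A \<union> A\<inverse>)\<^sup>*" using assms(6) sub by blast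
  have "(x, y) \<in> (A \<union> A\<inverse>)\<^sup>* \<longleftrightarrow> (y, r) \<in> A\<^sup>*" for y
  proof
    assume "(x, y) \<in> (A \<union> A\<inverse>)\<^sup>*"
    then have "(y, r) \<in> (A \<union> A\<inverse>)\<^sup>*" using xr symD[OF s, of x y] by (meson rtrancl_trans)
    then obtain z where "(y, z) \<in> A\<^sup>*" "(r, z) \<in> A\<^sup>*"
      using single_valued_connected_imp_joinable[OF A(2)] by blast
    moreover have "z = r" using calculation(2) A(4) assms(5) by (intro rtrancl_from_sink[of r z A]) auto
    ultimately show "(y, r) \<in> A\<^sup>*" by simp
  next
    assume "(y, r) \<in> A\<^sup>*"
    then show "(x, y) \<in> (A \<union> A\<inverse>)\<^sup>*"
      using xr sub symD[OF s, of y r] by (meson rtrancl_trans subsetD)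
  qed
  then show ?thesis by (auto simp: comp_of_def)
qed

lemma weak_components_in_forest:
  assumes "finite E" "E \<subseteq> V \<times> V" "A \<in> in_forests V E R" "R \<subseteq> V"
  shows "weak_components (digraph_on V A) = (\<lambda>r. {x \<in> V. (x, r) \<in> A\<^sup>*}) ` R"
    and "inj_on (\<lambda>r. {x \<in> V. (x, r) \<in> A\<^sup>*}) R"
proof -
  have sub: "A \<subseteq> V \<times> V" using in_forestsD(1)[OF assms(3)] assms(2) by auto
  have "comp_of V A ` V = (\<lambda>r. {x \<in> V. (x, r) \<in> A\<^sup>*}) ` R"
  proof (intro equalityI subsetI)
    fix S assume "S \<in> comp_of V A ` V"
    then obtain x where x: "x \<in> V" "S = comp_of V A x" by blast
    then obtain r where "r \<in> R" "(x, r) \<in> A\<^sup>*" using in_forests_root[OF assms(1-3)] by blast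
    then show "S \<in> (\<lambda>r. {x \<in> V. (x, r) \<in> A\<^sup>*}) ` R" using x comp_of_in_forest[OF assms] by blast
  next
    fix S assume "S \<in> (\<lambda>r. {x \<in> V. (x, r) \<in> A\<^sup>*}) ` R"
    then obtain r where "r \<in> R" "S = {x \<in> V. (x, r) \<in> A\<^sup>*}" by blast
    then have "S = comp_of V A r" "r \<in> V" using comp_of_in_forest[OF assms, of r r] assms(4) by auto
    then show "S \<in> comp_of V A ` V" by blast
  qed
  then show "weak_components (digraph_on V A) = (\<lambda>r. {x \<in> V. (x, r) \<in> A\<^sup>*}) ` R"
    using weak_components_digraph_on[OF sub] by simp
  show "inj_on (\<lambda>r. {x \<in> V. (x, r) \<in> A\<^sup>*}) R"
  proof (rule inj_onI)
    fix r s assume rs: "r \<in> R" "s \<in> R" "{x \<in> V. (x, r) \<in> A\<^sup>*} = {x \<in> V. (x, s) \<in> A\<^sup>*}"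
    then have "(r, s) \<in> A\<^sup>*" using assms(4) by blast
    then show "r = s" using in_forests_root_unique[OF assms(3) rs(1,2), of r] by simp
  qed
qed

text \<open>
  A walk in a single-valued relation has no choice, and at a sink it has to stop.
\<close>
lemma awalk_to_sink_unique:
  assumes "single_valued A" "r \<notin> Domain A"
    and "pcas a p r" "set p \<subseteq> A" "pcas a q r" "set q \<subseteq> A"
  shows "p = q"
  using assms(3-6)
proof (induction p arbitrary: a q)
  case Nil
  then show ?case using assms(2) by (cases q) auto
next
  case (Cons e p)
  then obtain b where e: "e = (a, b)" "(a, b) \<in> A" by (cases e) auto
  then have "a \<noteq> r" using assms(2) by auto
  then obtain f q' where q: "q = f # q'" using Cons.prems(3) by (cases q) auto
  then obtain c where f: "f = (a, c)" "(a, c) \<in> A" using Cons.prems by (cases f) auto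
  have "c = b" using e f assms(1) by (auto simp: single_valued_def)
  then show ?case using Cons.IH[of b q'] Cons.prems q e f by auto
qed

lemma is_root_in_forest:
  assumes "finite E" "E \<subseteq> V \<times> V" "A \<in> in_forests V E R" "R \<subseteq> V" "r \<in> R"
  shows "is_root (digraph_on V A) {x \<in> V. (x, r) \<in> A\<^sup>*} s \<longleftrightarrow> s = r"
proof
  note A = in_forestsD[OF assms(3)]
  have sub: "A \<subseteq> V \<times> V" using A(1) assms(2) by auto
  interpret pair_wf_digraph "digraph_on V A" using sub by (rule pair_wf_digraph_digraph_on)
  have sink: "r \<notin> Domain A" using A(4) assms(5) by auto
  {
    assume "is_root (digraph_on V A) {x \<in> V. (x, r) \<in> A\<^sup>*} s"
    moreover have "r \<in> {x \<in> V. (x, r) \<in> A\<^sup>*}" using assms(4,5) by auto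
    ultimately have "\<exists>p. apath r p s" unfolding is_root_def by blast
    then have "(r, s) \<in> A\<^sup>*" using ex_apath_digraph_on[OF sub] by blast
    then show "s = r" using sink by (rule rtrancl_from_sink)
  next
    assume "s = r"
    moreover have "\<exists>!p. apath a p r" if "a \<in> V" "(a, r) \<in> A\<^sup>*" for a
    proof (rule ex_ex1I)
      show "\<exists>p. apath a p r" using that ex_apath_digraph_on[OF sub] by blast
      fix p q assume "apath a p r" "apath a q r"
      then show "p = q"
        using awalk_to_sink_unique[OF A(2) sink, of a p q] by (auto simp: apath_def awalk_def)
    qed
    ultimately show "is_root (digraph_on V A) {x \<in> V. (x, r) \<in> A\<^sup>*} s"
      using assms(4,5) by (auto simp: is_root_def)
  }
qed

lemma component_root_in_forest:
  assumes "finite E" "E \<subseteq> V \<times> V" "A \<in> in_forests V E R" "R \<subseteq> V" "r \<in> R"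
  shows "component_root (digraph_on V A) {x \<in> V. (x, r) \<in> A\<^sup>*} = r"
  unfolding component_root_def using is_root_in_forest[OF assms] by (intro the_equality) auto

context pair_digraph
begin

abbreviation "V \<equiv> pverts G"
abbreviation "E \<equiv> parcs G"

lemma arcs_subset: "E \<subseteq> V \<times> V"
  using in_arcsD1 in_arcsD2 by auto

lemma spanning_iff:
  "spanning (with_proj F) (with_proj G) \<longleftrightarrow> pverts F = V \<and> parcs F \<subseteq> E"
proof
  assume "pverts F = V \<and> parcs F \<subseteq> E"
  moreover from this have "pair_wf_digraph F"
    using arcs_subset by unfold_locales auto
  then have "wf_digraph (with_proj F)" by (simp add: wf_digraph_wp_iff)
  ultimately show "spanning (with_proj F) (with_proj G)"
    using wf_digraph by (auto simp: spanning_def subgraph_def compatible_def)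
qed (auto simp: spanning_def subgraph_def)

lemma undirected_forest_iff:
  assumes "A \<subseteq> E"
  shows "undirected_forest k (digraph_on V A) \<longleftrightarrow>
    all_bridges (A \<union> A\<inverse>) \<and> card (weak_components (digraph_on V A)) = k"
proof -
  have "A \<union> A\<inverse> \<subseteq> V \<times> V" "(a, a) \<notin> A \<union> A\<inverse>" for a
    using assms arcs_subset no_loops' by auto
  then show ?thesis
    unfolding undirected_forest_def mk_symmetric_digraph_on by (subst no_long_cycle_iff_all_bridges) auto
qed

text \<open>
  From left to right, acyclicity and uniqueness of out-arcs follow from the absence of undirected cycles and the
  existence of paths to the root. Because components correspond to roots, their number is the number of vertices
  without out-arc.
\<close>
theorem rooted_forests_eq:
  "rooted_forests G k = digraph_on V ` (\<Union>R\<in>{R. R \<subseteq> V \<and> card R = k}. in_forests V E R)"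
proof (intro equalityI subsetI)
  fix F assume "F \<in> rooted_forests G k"
  then have "pverts F = V" and F: "parcs F \<subseteq> E" "undirected_forest k F"
    "\<And>a b. (a, b) \<in> parcs F \<Longrightarrow> (b, a) \<notin> parcs F"
    "\<And>C. C \<in> weak_components F \<Longrightarrow> \<exists>r. is_root F C r"
    by (auto simp: rooted_forests_def spanning_iff)
  define A where "A = parcs F"
  have FA: "F = digraph_on V A" using \<open>pverts F = V\<close> by (simp add: A_def)
  note F = F[folded A_def, unfolded FA]
  have sub: "A \<subseteq> V \<times> V" using F(1) arcs_subset by auto
  have bridges: "all_bridges (A \<union> A\<inverse>)" and card: "card (weak_components (digraph_on V A)) = k"
    using F(2) undirected_forest_iff[OF F(1)] by auto
  have acyclic: "acyclic A" using bridges F(3) by (rule acyclic_if_all_bridges)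
  have "single_valued A"
    unfolding single_valued_def
  proof (intro allI impI)
    fix a b c assume ab: "(a, b) \<in> A" and ac: "(a, c) \<in> A"
    then have V: "a \<in> V" "b \<in> V" "c \<in> V" using sub by auto
    then obtain r where r: "is_root (digraph_on V A) (comp_of V A a) r"
      using F(4) weak_components_digraph_on[OF sub] by blast
    have "b \<in> comp_of V A a" "c \<in> comp_of V A a" using ab ac V by (auto simp: comp_of_def)
    then have "(b, r) \<in> A\<^sup>*" "(c, r) \<in> A\<^sup>*"
      using r ex_apath_digraph_on[OF sub] unfolding is_root_def by blast+
    then show "b = c" using unique_out_arc_if_all_bridges[OF bridges acyclic ab ac] by blast
  qed
  then have A: "A \<in> in_forests V E (V - Domain A)"
    using F(1) acyclic sub by (auto simp: in_forests_def)
  have "card (V - Domain A) = k"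
    using card weak_components_in_forest[OF pair_finite_arcs arcs_subset A] by (simp add: card_image)
  then show "F \<in> digraph_on V ` (\<Union>R\<in>{R. R \<subseteq> V \<and> card R = k}. in_forests V E R)"
    unfolding FA using A by (intro imageI UN_I[of "V - Domain A"]) auto
next
  fix F assume "F \<in> digraph_on V ` (\<Union>R\<in>{R. R \<subseteq> V \<and> card R = k}. in_forests V E R)"
  then obtain A R where F: "F = digraph_on V A" and A: "A \<in> in_forests V E R" and R: "R \<subseteq> V" "card R = k"
    by blast
  note wc = weak_components_in_forest[OF pair_finite_arcs arcs_subset A R(1)]
  have "undirected_forest k F"
    unfolding F undirected_forest_iff[OF in_forestsD(1)[OF A]]
    using all_bridges_of_in_forest in_forestsD(2,3)[OF A] wc R(2) by (auto simp: card_image)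
  moreover have "\<forall>C\<in>weak_components F. \<exists>r. is_root F C r"
    using is_root_in_forest[OF pair_finite_arcs arcs_subset A R(1)] unfolding F wc(1) by auto
  ultimately show "F \<in> rooted_forests G k"
    using in_forestsD(1)[OF A] in_forests_no_antiparallel[OF A]
    by (auto simp: rooted_forests_def spanning_iff F)
qed

lemma tree_root_in_tree:
  assumes A: "A \<in> in_forests V E {r}" and r: "r \<in> V"
  shows "tree_root (digraph_on V A) = r"
proof -
  have "{x \<in> V. (x, r) \<in> A\<^sup>*} = V" using in_forests_root[OF pair_finite_arcs arcs_subset A] by auto
  then show ?thesis
    using component_root_in_forest[OF pair_finite_arcs arcs_subset A, of r] r by (simp add: tree_root_def)
qed

lemma rooted_trees_eq: "rooted_forests G 1 = (\<Union>r\<in>V. digraph_on V ` in_forests V E {r})"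
proof -
  have "{R. R \<subseteq> V \<and> card R = 1} = (\<lambda>r. {r}) ` V" by (auto simp: card_1_singleton_iff)
  then show ?thesis unfolding rooted_forests_eq by (simp add: image_UN)
qed

lemma trees_with_root_eq:
  assumes "w \<in> V"
  shows "{T \<in> rooted_forests G 1. tree_root T = w} = digraph_on V ` in_forests V E {w}"
  unfolding rooted_trees_eq using tree_root_in_tree assms by auto

lemma rooted_2_forests_sep_eq:
  assumes v: "v \<in> V" and u: "u \<in> V"
  shows "rooted_2_forests_sep G u v =
    (\<lambda>(r, A). (digraph_on V A, {x \<in> V. (x, v) \<in> A\<^sup>*}, {x \<in> V. (x, r) \<in> A\<^sup>*})) `
      (SIGMA r:V - {v}. {A \<in> in_forests V E {v, r}. (u, r) \<in> A\<^sup>*})"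
    (is "_ = ?f ` ?S")
proof (intro equalityI subsetI)
  fix t assume "t \<in> rooted_2_forests_sep G u v"
  then obtain F T1 T2 where t: "t = (F, T1, T2)" and F: "F \<in> rooted_forests G 2"
    "weak_components F = {T1, T2}" "u \<in> T2" "v = component_root F T1"
    by (auto simp: rooted_2_forests_sep_def)
  then obtain A R where FA: "F = digraph_on V A" and A: "A \<in> in_forests V E R" and R: "R \<subseteq> V" "card R = 2"
    unfolding rooted_forests_eq by blast
  note wc = weak_components_in_forest[OF pair_finite_arcs arcs_subset A R(1)]
  note cr = component_root_in_forest[OF pair_finite_arcs arcs_subset A R(1)]
  let ?c = "\<lambda>r. {x \<in> V. (x, r) \<in> A\<^sup>*}"
  have T: "{T1, T2} = ?c ` R" using F(2) wc(1) FA by simp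
  have "T1 \<in> ?c ` R" "T2 \<in> ?c ` R" using T by auto
  then obtain a r where a: "a \<in> R" "T1 = ?c a" and r: "r \<in> R" "T2 = ?c r" by blast
  have "a = v" using F(4) cr[OF a(1)] a(2) FA by simp
  have "card (?c ` R) = 2" using wc(2) R(2) by (simp add: card_image)
  then have "T1 \<noteq> T2" using T by (metis card_1_singleton_iff insert_absorb2 numeral_eq_one_iff semiring_norm(85) One_nat_def)
  then have "r \<noteq> v" using a r \<open>a = v\<close> by auto
  moreover have "R = {v, r}"
    using R(2) a(1) r(1) \<open>a = v\<close> \<open>r \<noteq> v\<close> by (auto simp: card_2_iff)
  ultimately have "(r, A) \<in> ?S" using A r F(3) R(1) by auto
  moreover have "t = ?f (r, A)" using t FA a r \<open>a = v\<close> by simp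
  ultimately show "t \<in> ?f ` ?S" by blast
next
  fix t assume "t \<in> ?f ` ?S"
  then obtain r A where r: "r \<in> V" "r \<noteq> v" and A: "A \<in> in_forests V E {v, r}" "(u, r) \<in> A\<^sup>*"
    and t: "t = ?f (r, A)" by blast
  have R: "{v, r} \<subseteq> V" "card {v, r} = 2" using v r by auto
  note wc = weak_components_in_forest[OF pair_finite_arcs arcs_subset A(1) R(1)]
  note cr = component_root_in_forest[OF pair_finite_arcs arcs_subset A(1) R(1)]
  have "digraph_on V A \<in> rooted_forests G 2" using A R unfolding rooted_forests_eq by blast
  then show "t \<in> rooted_2_forests_sep G u v"
    using wc(1) cr[of v] A(2) u by (simp add: t rooted_2_forests_sep_def)
qed

lemma unrooted_forests_eq:
  "unrooted_forests G k = digraph_on V ` {B. B \<subseteq> E \<and> sym B \<and> all_bridges B \<and> card (comp_of V B ` V) = k}"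
proof -
  have iff: "digraph_on V B \<in> unrooted_forests G k \<longleftrightarrow>
      B \<subseteq> E \<and> sym B \<and> all_bridges B \<and> card (comp_of V B ` V) = k" for B
  proof (cases "B \<subseteq> E \<and> sym B")
    case True
    then have "B \<union> B\<inverse> = B" "B \<subseteq> V \<times> V" using arcs_subset by (auto simp: sym_conv_converse_eq)
    then show ?thesis
      using True undirected_forest_iff[of B k] weak_components_digraph_on[of B V]
      by (simp add: unrooted_forests_def spanning_iff symmetric_def)
  next
    case False
    then show ?thesis by (auto simp: unrooted_forests_def spanning_iff symmetric_def)
  qed
  have ex: "\<exists>B. F = digraph_on V B" if "F \<in> unrooted_forests G k" for F
    using that by (cases F) (auto simp: unrooted_forests_def spanning_iff)
  show ?thesis
  proof (intro equalityI subsetI)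
    fix F assume F: "F \<in> unrooted_forests G k"
    obtain B where B: "F = digraph_on V B" using ex[OF F] by blast
    show "F \<in> digraph_on V ` {B. B \<subseteq> E \<and> sym B \<and> all_bridges B \<and> card (comp_of V B ` V) = k}"
      using F unfolding B by (intro imageI) (simp add: iff)
  next
    fix F assume "F \<in> digraph_on V ` {B. B \<subseteq> E \<and> sym B \<and> all_bridges B \<and> card (comp_of V B ` V) = k}"
    then show "F \<in> unrooted_forests G k" using iff by blast
  qed
qed

lemma comp_of_symcl: "comp_of V (A \<union> A\<inverse>) = comp_of V A"
  by (simp add: comp_of_def fun_eq_iff Un_commute Un_left_commute converse_Un)

lemma comp_of_eqI:
  assumes "y \<in> comp_of V B x" shows "comp_of V B y = comp_of V B x"
proof -
  have s: "sym ((B \<union> B\<inverse>)\<^sup>*)" by (rule sym_rtrancl) (auto simp: sym_def)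
  have xy: "(x, y) \<in> (B \<union> B\<inverse>)\<^sup>*" using assms by (simp add: comp_of_def)
  then have "(x, z) \<in> (B \<union> B\<inverse>)\<^sup>* \<longleftrightarrow> (y, z) \<in> (B \<union> B\<inverse>)\<^sup>*" for z
    using symD[OF s xy] by (meson rtrancl_trans)
  then show ?thesis by (simp add: comp_of_def)
qed

lemma unrooted_trees_eq:
  assumes sym: "sym E" and v: "v \<in> V"
  shows "unrooted_forests G 1 = (\<lambda>A. digraph_on V (A \<union> A\<inverse>)) ` in_forests V E {v}"
proof (intro equalityI subsetI)
  fix F assume "F \<in> unrooted_forests G 1"
  then obtain B where F: "F = digraph_on V B" and B: "B \<subseteq> E" "sym B" "all_bridges B" "card (comp_of V B ` V) = 1"
    unfolding unrooted_forests_eq by blast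
  have BB: "B \<union> B\<inverse> = B" using B(2) by (auto simp: sym_conv_converse_eq)
  obtain S where S: "comp_of V B ` V = {S}" using B(4) by (auto simp: card_1_singleton_iff)
  have "(x, v) \<in> B\<^sup>*" if "x \<in> V" for x
  proof -
    have "comp_of V B x \<in> {S}" "comp_of V B v \<in> {S}" unfolding S[symmetric] using that v by auto
    then have "comp_of V B x = comp_of V B v" by simp
    moreover have "v \<in> comp_of V B v" using v by (simp add: comp_of_def)
    ultimately have "v \<in> comp_of V B x" by simp
    then show ?thesis by (simp add: comp_of_def BB)
  qed
  then have "B \<in> edge_forests V E {v}"
    using B v by (auto simp: edge_forests_def transversal_def)
  then have "orient B {v} \<in> in_forests V E {v}" "B = orient B {v} \<union> (orient B {v})\<inverse>"
    using orient_in_forests[OF arcs_subset] orient_symcl[OF arcs_subset] by auto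
  then show "F \<in> (\<lambda>A. digraph_on V (A \<union> A\<inverse>)) ` in_forests V E {v}"
    unfolding F by (intro image_eqI[of _ _ "orient B {v}"]) auto
next
  fix F assume "F \<in> (\<lambda>A. digraph_on V (A \<union> A\<inverse>)) ` in_forests V E {v}"
  then obtain A where A: "A \<in> in_forests V E {v}" and F: "F = digraph_on V (A \<union> A\<inverse>)" by blast
  have "comp_of V (A \<union> A\<inverse>) ` V = {{x \<in> V. (x, v) \<in> A\<^sup>*}}"
    using weak_components_in_forest(1)[OF pair_finite_arcs arcs_subset A] v
      weak_components_digraph_on[of A V] in_forestsD(1)[OF A] arcs_subset
    by (auto simp: comp_of_symcl)
  moreover have "A \<union> A\<inverse> \<in> edge_forests V E {v}"
    using symcl_in_forest(1)[OF pair_finite_arcs arcs_subset sym _ A] v by simp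
  ultimately show "F \<in> unrooted_forests G 1"
    unfolding F unrooted_forests_eq by (intro imageI) (auto simp: edge_forests_def)
qed

text \<open>
  An undirected 2-forest that separates \<open>u\<close> from \<open>v\<close>, with a distinguished vertex
  \<open>r\<close> of the component of \<open>u\<close>, is the same as a rooted forest with roots
  \<open>v\<close> and \<open>r\<close> in which \<open>u\<close> belongs to the tree of \<open>r\<close>:
  orient the edges towards \<open>{v, r}\<close>. The sum over \<open>r\<close> of the degrees is the volume of
  the component.
\<close>
lemma unrooted_2_forests_sep_pointed_eq:
  assumes sym: "sym E" and v: "v \<in> V" and u: "u \<in> V"
  shows "(SIGMA t:unrooted_2_forests_sep G u v. snd (snd t)) =
    (\<lambda>(r, A). ((digraph_on V (A \<union> A\<inverse>), {x \<in> V. (x, v) \<in> A\<^sup>*}, {x \<in> V. (x, r) \<in> A\<^sup>*}), r)) `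
      (SIGMA r:V - {v}. {A \<in> in_forests V E {v, r}. (u, r) \<in> A\<^sup>*})"
    (is "_ = ?f ` ?S")
proof (intro equalityI subsetI)
  fix p assume "p \<in> (SIGMA t:unrooted_2_forests_sep G u v. snd (snd t))"
  then obtain F T1 T2 r where p: "p = ((F, T1, T2), r)" and F: "F \<in> unrooted_forests G 2"
    "weak_components F = {T1, T2}" "u \<in> T2" "v \<in> T1" "r \<in> T2"
    by (auto simp: unrooted_2_forests_sep_def)
  obtain B where FB: "F = digraph_on V B" and B: "B \<subseteq> E" "sym B" "all_bridges B" "card (comp_of V B ` V) = 2"
    using F(1) unfolding unrooted_forests_eq by blast
  have BB: "B \<union> B\<inverse> = B" using B(2) by (auto simp: sym_conv_converse_eq)
  have BV: "B \<subseteq> V \<times> V" using B(1) arcs_subset by auto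
  have T: "comp_of V B ` V = {T1, T2}" using F(2) weak_components_digraph_on[OF BV] FB by simp
  have ne: "T1 \<noteq> T2" using B(4) unfolding T by auto
  have "T1 \<in> comp_of V B ` V" "T2 \<in> comp_of V B ` V" unfolding T by auto
  then have T12: "T1 = comp_of V B v" "T2 = comp_of V B r"
    using F(4,5) comp_of_eqI by (metis imageE)+
  have rV: "r \<in> V" using F(5) T12(2) by (auto simp: comp_of_def)
  have reach: "(x, y) \<in> B\<^sup>* \<longleftrightarrow> comp_of V B x = comp_of V B y" if "x \<in> V" "y \<in> V" for x y
  proof
    assume "(x, y) \<in> B\<^sup>*"
    then have "y \<in> comp_of V B x" using that by (simp add: comp_of_def BB)
    then show "comp_of V B x = comp_of V B y" by (rule comp_of_eqI[symmetric])
  next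
    assume "comp_of V B x = comp_of V B y"
    moreover have "y \<in> comp_of V B y" using that by (simp add: comp_of_def)
    ultimately have "y \<in> comp_of V B x" by simp
    then show "(x, y) \<in> B\<^sup>*" by (simp add: comp_of_def BB)
  qed
  have "\<exists>!s. s \<in> {v, r} \<and> (x, s) \<in> B\<^sup>*" if x: "x \<in> V" for x
  proof -
    have "(x, v) \<in> B\<^sup>* \<longleftrightarrow> comp_of V B x = T1" "(x, r) \<in> B\<^sup>* \<longleftrightarrow> comp_of V B x = T2"
      using reach x v rV T12 by auto
    moreover have "comp_of V B x = T1 \<or> comp_of V B x = T2" using x T by blast
    ultimately have "((x, v) \<in> B\<^sup>*) \<noteq> ((x, r) \<in> B\<^sup>*)" using ne by metis
    then show ?thesis by blast
  qed
  then have EF: "B \<in> edge_forests V E {v, r}"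
    using B v rV by (auto simp: edge_forests_def transversal_def)
  define A where "A = orient B {v, r}"
  have A: "A \<in> in_forests V E {v, r}" and AB: "A \<union> A\<inverse> = B"
    unfolding A_def using orient_in_forests[OF arcs_subset EF] orient_symcl[OF arcs_subset EF] by auto
  have R: "{v, r} \<subseteq> V" using v rV by auto
  have c: "{x \<in> V. (x, s) \<in> A\<^sup>*} = comp_of V B s" if "s \<in> {v, r}" for s
    using comp_of_in_forest[OF pair_finite_arcs arcs_subset A R that, of s] that R
    by (auto simp: comp_of_symcl AB[symmetric])
  have "(u, r) \<in> A\<^sup>*" using F(3) c[of r] T12 by auto
  moreover have "r \<noteq> v" using ne T12 by auto
  ultimately have "(r, A) \<in> ?S" using A rV by auto
  moreover have "p = ?f (r, A)" using c[of v] c[of r] by (simp add: p FB AB T12)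
  ultimately show "p \<in> ?f ` ?S" by blast
next
  fix p assume "p \<in> ?f ` ?S"
  then obtain r A where r: "r \<in> V" "r \<noteq> v" and A: "A \<in> in_forests V E {v, r}" "(u, r) \<in> A\<^sup>*"
    and p: "p = ?f (r, A)" by blast
  have R: "{v, r} \<subseteq> V" "card {v, r} = 2" using v r by auto
  let ?B = "A \<union> A\<inverse>"
  have AE: "A \<subseteq> V \<times> V" using in_forestsD(1)[OF A(1)] arcs_subset by auto
  note wc = weak_components_in_forest[OF pair_finite_arcs arcs_subset A(1) R(1)]
  have "?B \<in> edge_forests V E {v, r}"
    using symcl_in_forest(1)[OF pair_finite_arcs arcs_subset sym R(1) A(1)] .
  moreover have cB: "comp_of V ?B ` V = (\<lambda>r. {x \<in> V. (x, r) \<in> A\<^sup>*}) ` {v, r}"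
    using wc(1) weak_components_digraph_on[OF AE] by (simp add: comp_of_symcl)
  moreover have "card \<dots> = 2" using wc(2) R(2) by (simp only: card_image)
  ultimately have "digraph_on V ?B \<in> unrooted_forests G 2"
    unfolding unrooted_forests_eq by (intro imageI) (simp add: edge_forests_def)
  moreover have "weak_components (digraph_on V ?B) = (\<lambda>r. {x \<in> V. (x, r) \<in> A\<^sup>*}) ` {v, r}"
    using cB weak_components_digraph_on[of ?B V] AE by auto
  ultimately show "p \<in> (SIGMA t:unrooted_2_forests_sep G u v. snd (snd t))"
    using A(2) u v r by (auto simp: p unrooted_2_forests_sep_def)
qed

end

lemma undirected_forest_weight_symcl:
  assumes anti: "\<And>a b. (a, b) \<in> A \<Longrightarrow> (b, a) \<notin> A" and sym: "\<And>a b. \<omega> (a, b) = \<omega> (b, a)"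
  shows "undirected_forest_weight \<omega> (digraph_on V (A \<union> A\<inverse>)) = prod \<omega> A"
proof -
  have w: "undirected_edge_weight \<omega> {a, b} = \<omega> (a, b)" for a b
    unfolding undirected_edge_weight_def
    by (rule the_equality) (use sym in \<open>auto simp: doubleton_eq_iff\<close>)
  have edges: "{{a, b} | a b. (a, b) \<in> A \<union> A\<inverse>} = (\<lambda>(a, b). {a, b}) ` A"
    by (auto simp: insert_commute image_iff)
  have "inj_on (\<lambda>(a, b). {a, b}) A"
    using anti by (auto simp: inj_on_def doubleton_eq_iff)
  then show ?thesis
    unfolding undirected_forest_weight_def pair_pre_digraph.simps edges
    by (subst prod.reindex) (auto simp: w intro!: prod.cong)
qed

section \<open>Hitting times as the solution of a linear system\<close>

subsection \<open>Staying in a finite set\<close>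

lemma sets_random_walk:
  "sets (random_walk G \<omega> u) = sets (PiM UNIV (\<lambda>_. count_space UNIV))"
  and space_random_walk: "space (random_walk G \<omega> u) = UNIV"
proof -
  interpret Ionescu_Tulcea "rw_kernel G \<omega> u" "\<lambda>_. count_space UNIV"
    by (rule Ionescu_Tulcea_rw_kernel)
  show "sets (random_walk G \<omega> u) = sets (PiM UNIV (\<lambda>_. count_space UNIV))"
    "space (random_walk G \<omega> u) = UNIV"
    by (auto simp: random_walk_def space_PiM)
qed

lemma prob_space_random_walk:
  fixes G :: "'a pair_pre_digraph"
  shows "prob_space (random_walk G \<omega> u)"
proof -
  interpret Ionescu_Tulcea "rw_kernel G \<omega> u" "\<lambda>_. count_space UNIV"
    by (rule Ionescu_Tulcea_rw_kernel)
  have "prob_space (distr PF.lim (PiM {} (\<lambda>_. count_space UNIV)) (\<lambda>x. restrict x {}))"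
    by (subst distr_lim) (auto intro: PF.prob_space_P)
  then show ?thesis
    unfolding random_walk_def
    by (rule prob_space_distrD[rotated])
       (auto simp: measurable_cong_sets[OF PF.sets_lim refl] intro!: measurable_restrict measurable_component_singleton)
qed

lemma finite_dim_event_measurable:
  fixes W :: "nat \<Rightarrow> 'v set"
  shows "{X. \<forall>i\<le>n. X i \<in> W i} \<in> sets (random_walk G \<omega> u)"
proof -
  let ?M = "PiM UNIV (\<lambda>_::nat. count_space (UNIV :: 'v set))"
  have "(\<lambda>X. X i) -` W i \<inter> space ?M \<in> sets ?M" for i
    by (rule measurable_sets[OF measurable_component_singleton]) auto
  then have "(\<Inter>i\<in>{..n}. (\<lambda>X. X i) -` W i \<inter> space ?M) \<in> sets ?M"
    by (intro sets.finite_INT) auto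
  also have "(\<Inter>i\<in>{..n}. (\<lambda>X. X i) -` W i \<inter> space ?M) = {X. \<forall>i\<le>n. X i \<in> W i}"
    by (auto simp: space_PiM)
  finally show ?thesis by (simp add: sets_random_walk)
qed

definition stay_prob ::
    "'v pair_pre_digraph \<Rightarrow> ('v \<times> 'v \<Rightarrow> real) \<Rightarrow> 'v set \<Rightarrow> nat \<Rightarrow> 'v \<Rightarrow> ennreal" where
  "stay_prob G \<omega> W n u = emeasure (random_walk G \<omega> u) {X. \<forall>i\<le>n. X i \<in> W}"

text \<open>
  The event is the disjoint union of the cylinders over the paths in \<open>W\<close>, whose probabilities are
  products.
\<close>
lemma stay_prob_eq_sum_paths:
  fixes G :: "'v pair_pre_digraph"
  assumes "finite W"
  shows "stay_prob G \<omega> W n u = (\<Sum>xs | set xs \<subseteq> W \<and> length xs = Suc n.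
     if xs ! 0 = u then (\<Prod>i<n. ennreal (pmf (rw_step G \<omega> (xs ! i)) (xs ! Suc i))) else 0)"
proof -
  let ?L = "{xs. set xs \<subseteq> W \<and> length xs = Suc n}"
  let ?C = "\<lambda>xs. {X :: nat \<Rightarrow> 'v. \<forall>i\<le>n. X i = xs ! i}"
  have "{X. \<forall>i\<le>n. X i \<in> W} = (\<Union>xs\<in>?L. ?C xs)"
  proof (intro equalityI subsetI)
    fix X :: "nat \<Rightarrow> 'v" assume X: "X \<in> {X. \<forall>i\<le>n. X i \<in> W}"
    show "X \<in> (\<Union>xs\<in>?L. ?C xs)"
      by (rule UN_I[of "map X [0..<Suc n]"]) (use X in \<open>auto simp del: upt_Suc simp: less_Suc_eq_le\<close>)
  next
    fix X :: "nat \<Rightarrow> 'v" assume "X \<in> (\<Union>xs\<in>?L. ?C xs)"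
    then obtain xs where "set xs \<subseteq> W" "length xs = Suc n" "\<forall>i\<le>n. X i = xs ! i" by blast
    then show "X \<in> {X. \<forall>i\<le>n. X i \<in> W}"
      using nth_mem[of _ xs] by (auto simp: less_Suc_eq_le)
  qed
  moreover have "disjoint_family_on ?C ?L"
    unfolding disjoint_family_on_def
  proof (intro ballI impI)
    fix xs ys assume xs: "xs \<in> ?L" "ys \<in> ?L" "xs \<noteq> ys"
    show "?C xs \<inter> ?C ys = {}"
    proof (rule ccontr)
      assume "?C xs \<inter> ?C ys \<noteq> {}"
      then have "\<forall>i\<le>n. xs ! i = ys ! i" by fastforce
      then show False using xs by (auto simp: list_eq_iff_nth_eq less_Suc_eq_le)
    qed
  qed
  moreover have "?C ` ?L \<subseteq> sets (random_walk G \<omega> u)"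
  proof safe
    fix xs :: "'v list"
    show "?C xs \<in> sets (random_walk G \<omega> u)"
      using finite_dim_event_measurable[of n "\<lambda>i. {xs ! i}" G \<omega> u] by simp
  qed
  moreover have "finite ?L" using assms by (rule finite_lists_length_eq)
  ultimately have "stay_prob G \<omega> W n u = (\<Sum>xs\<in>?L. emeasure (random_walk G \<omega> u) (?C xs))"
    unfolding stay_prob_def by (simp add: sum_emeasure)
  then show ?thesis by (simp only: emeasure_random_walk_path)
qed

lemma stay_prob_0: "finite W \<Longrightarrow> stay_prob G \<omega> W 0 u = (if u \<in> W then 1 else 0)"
proof -
  assume "finite W"
  have "{xs. set xs \<subseteq> W \<and> length xs = Suc 0} = (\<lambda>a. [a]) ` W"
    by (auto simp: length_Suc_conv)
  then show ?thesis
    using \<open>finite W\<close> by (simp add: stay_prob_eq_sum_paths sum.reindex inj_on_def)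
qed

text \<open>
  The Markov property at time 1, obtained by splitting off the first vertex of a path.
\<close>
lemma stay_prob_Suc:
  assumes "finite W"
  shows "stay_prob G \<omega> W (Suc n) u =
    (if u \<in> W then \<Sum>w\<in>W. ennreal (pmf (rw_step G \<omega> u) w) * stay_prob G \<omega> W n w else 0)"
proof -
  let ?L = "{xs. set xs \<subseteq> W \<and> length xs = Suc n}"
  let ?p = "\<lambda>a b. ennreal (pmf (rw_step G \<omega> a) b)"
  let ?q = "\<lambda>xs. \<Prod>i<n. ?p (xs ! i) (xs ! Suc i)"
  have fin: "finite ?L" using assms by (rule finite_lists_length_eq)
  have "stay_prob G \<omega> W (Suc n) u =
      (\<Sum>(xs, a)\<in>?L \<times> W. if a = u then ?p a (xs ! 0) * ?q xs else 0)"
    unfolding stay_prob_eq_sum_paths[OF assms] lists_length_Suc_eq[of W "Suc n"]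
    by (subst sum.reindex)
       (auto simp: inj_on_def prod.lessThan_Suc_shift simp del: prod.lessThan_Suc intro!: sum.cong)
  also have "\<dots> = (\<Sum>xs\<in>?L. \<Sum>a\<in>W. if a = u then ?p a (xs ! 0) * ?q xs else 0)"
    by (rule sum.cartesian_product[symmetric])
  also have "\<dots> = (\<Sum>xs\<in>?L. if u \<in> W then ?p u (xs ! 0) * ?q xs else 0)"
    using assms by (intro sum.cong) (auto simp: sum.delta)
  also have "\<dots> = (if u \<in> W then (\<Sum>xs\<in>?L. ?p u (xs ! 0) * ?q xs) else 0)" by simp
  also have "(\<Sum>xs\<in>?L. ?p u (xs ! 0) * ?q xs) =
      (\<Sum>xs\<in>?L. \<Sum>w\<in>W. if w = xs ! 0 then ?p u w * ?q xs else 0)"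
  proof (intro sum.cong refl)
    fix xs assume "xs \<in> ?L"
    then have "xs ! 0 \<in> W" by (auto simp: subset_iff)
    then show "?p u (xs ! 0) * ?q xs = (\<Sum>w\<in>W. if w = xs ! 0 then ?p u w * ?q xs else 0)"
      using assms by simp
  qed
  also have "\<dots> = (\<Sum>w\<in>W. ?p u w * (\<Sum>xs\<in>?L. if xs ! 0 = w then ?q xs else 0))"
    by (subst sum.swap) (auto simp: sum_distrib_left intro!: sum.cong)
  finally show ?thesis by (simp only: stay_prob_eq_sum_paths[OF assms])
qed

subsection \<open>The first-step equation\<close>

lemma less_first_hit_iff: "enat n < first_hit v X \<longleftrightarrow> (\<forall>i\<le>n. X i \<noteq> v)"
proof
  assume n: "enat n < first_hit v X"
  show "\<forall>i\<le>n. X i \<noteq> v"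
  proof (intro allI impI notI)
    fix i assume "i \<le> n" "X i = v"
    then have "first_hit v X \<le> enat i" unfolding first_hit_def by (auto intro: INF_lower)
    also have "\<dots> \<le> enat n" using \<open>i \<le> n\<close> by simp
    finally show False using n by simp
  qed
next
  assume "\<forall>i\<le>n. X i \<noteq> v"
  then have "enat (Suc n) \<le> first_hit v X"
    unfolding first_hit_def by (intro INF_greatest) (auto simp: Suc_le_eq not_le[symmetric])
  then show "enat n < first_hit v X" by (rule less_le_trans[rotated]) simp
qed

text \<open>
  The tail-sum formula for the expectation of a variable with values in the extended natural numbers.
\<close>
lemma hitting_time_eq_suminf:
  "hitting_time G \<omega> u v = (\<Sum>n. emeasure (random_walk G \<omega> u) {X. \<forall>i\<le>n. X i \<noteq> v})"
proof -
  have eq: "first_hit v = (\<lambda>X. INF n. if X n = v then enat n else \<infinity>)"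
  proof (intro ext antisym)
    fix X
    show "first_hit v X \<le> (INF n. if X n = v then enat n else \<infinity>)"
      unfolding first_hit_def by (intro INF_greatest) (auto intro: INF_lower)
    show "(INF n. if X n = v then enat n else \<infinity>) \<le> first_hit v X"
      unfolding first_hit_def
    proof (rule INF_greatest)
      fix n assume "n \<in> {n. X n = v}"
      then show "(INF n. if X n = v then enat n else \<infinity>) \<le> enat n"
        by (intro INF_lower2[of n]) auto
    qed
  qed
  have "first_hit v \<in> measurable (PiM UNIV (\<lambda>_. count_space UNIV)) (count_space UNIV)"
    unfolding eq by measurable
  then have "first_hit v \<in> measurable (random_walk G \<omega> u) (count_space UNIV)"
    by (simp add: measurable_cong_sets[OF sets_random_walk refl])
  then show ?thesis
    unfolding hitting_time_def
    by (simp add: nn_integral_enat_function space_random_walk less_first_hit_iff)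
qed

context weighted_digraph
begin

lemma weight_nonneg: "0 \<le> \<omega> e"
  using weight_pos[of e] weight_zero[of e] by (cases "e \<in> parcs G") auto

lemma wdegree_nonneg: "0 \<le> wdegree G \<omega> a"
  by (auto simp: wdegree_def intro: sum_nonneg weight_nonneg)

lemma sum_pmf_rw_step:
  assumes "a \<in> pverts G" "wdegree G \<omega> a \<noteq> 0"
  shows "(\<Sum>w\<in>pverts G. pmf (rw_step G \<omega> a) w) = 1"
  using assms by (simp add: pmf_rw_step sum_divide_distrib[symmetric] wdegree_def[symmetric])

context
  assumes degree: "\<And>a. a \<in> pverts G \<Longrightarrow> wdegree G \<omega> a \<noteq> 0"
begin

text \<open>
  The type of the vertices may be larger than the vertex set, even uncountable. That the walk almost surely
  stays in \<open>pverts G\<close> is seen here, where the probabilities of all paths in \<open>pverts G\<close>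
  are added up.
\<close>
lemma stay_prob_verts: "u \<in> pverts G \<Longrightarrow> stay_prob G \<omega> (pverts G) n u = 1"
proof (induction n arbitrary: u)
  case 0
  then show ?case by (simp add: stay_prob_0 pair_finite_verts)
next
  case (Suc n)
  then show ?case
    by (simp add: stay_prob_Suc pair_finite_verts sum_pmf_rw_step degree)
qed

lemma hitting_time_eq_stay_prob:
  assumes "u \<in> pverts G"
  shows "hitting_time G \<omega> u v = (\<Sum>n. stay_prob G \<omega> (pverts G - {v}) n u)"
proof -
  interpret prob_space "random_walk G \<omega> u" by (rule prob_space_random_walk)
  have ae: "AE X in random_walk G \<omega> u. \<forall>i\<le>n. X i \<in> pverts G" for n
  proof (rule AE_I_eq_1)
    show "{X \<in> space (random_walk G \<omega> u). \<forall>i\<le>n. X i \<in> pverts G} \<in> events"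
      using finite_dim_event_measurable[of n "\<lambda>_. pverts G" G \<omega> u] by (simp add: space_random_walk)
    show "emeasure (random_walk G \<omega> u) {X \<in> space (random_walk G \<omega> u). \<forall>i\<le>n. X i \<in> pverts G} = 1"
      using stay_prob_verts[OF assms, of n] by (simp add: stay_prob_def space_random_walk)
  qed
  have "emeasure (random_walk G \<omega> u) {X. \<forall>i\<le>n. X i \<noteq> v} =
      stay_prob G \<omega> (pverts G - {v}) n u" for n
    unfolding stay_prob_def
  proof (rule emeasure_eq_AE)
    show "AE X in random_walk G \<omega> u.
        (X \<in> {X. \<forall>i\<le>n. X i \<noteq> v}) = (X \<in> {X. \<forall>i\<le>n. X i \<in> pverts G - {v}})"
      using ae[of n] by (rule AE_mp) (rule AE_I2, auto)
    show "{X. \<forall>i\<le>n. X i \<noteq> v} \<in> events"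
      using finite_dim_event_measurable[of n "\<lambda>_. - {v}" G \<omega> u] by simp
  qed (rule finite_dim_event_measurable)
  then show ?thesis by (simp add: hitting_time_eq_suminf)
qed

lemma hitting_time_self: "v \<in> pverts G \<Longrightarrow> hitting_time G \<omega> v v = 0"
proof -
  assume v: "v \<in> pverts G"
  have "stay_prob G \<omega> (pverts G - {v}) n v = 0" for n
    by (cases n) (simp_all add: stay_prob_0 stay_prob_Suc pair_finite_verts)
  then show ?thesis using v by (simp add: hitting_time_eq_stay_prob)
qed

lemma hitting_time_step:
  assumes u: "u \<in> pverts G" "u \<noteq> v"
  shows "hitting_time G \<omega> u v =
    1 + (\<Sum>w\<in>pverts G. ennreal (\<omega> (u, w) / wdegree G \<omega> u) * hitting_time G \<omega> w v)"
proof -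
  let ?W = "pverts G - {v}"
  let ?s = "stay_prob G \<omega> ?W"
  have fin: "finite ?W" using pair_finite_verts by simp
  have "hitting_time G \<omega> u v = (\<Sum>n. ?s (Suc n) u) + ?s 0 u"
    using suminf_offset[of "\<lambda>n. ?s n u" 1] u by (simp add: hitting_time_eq_stay_prob)
  also have "?s 0 u = 1" using u fin by (simp add: stay_prob_0)
  also have "(\<Sum>n. ?s (Suc n) u) = (\<Sum>w\<in>?W. \<Sum>n. ennreal (pmf (rw_step G \<omega> u) w) * ?s n w)"
    using u by (simp add: stay_prob_Suc[OF fin] suminf_sum)
  also have "\<dots> = (\<Sum>w\<in>?W. ennreal (\<omega> (u, w) / wdegree G \<omega> u) * hitting_time G \<omega> w v)"
    using u by (intro sum.cong) (auto simp: hitting_time_eq_stay_prob pmf_rw_step degree)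
  also have "\<dots> = (\<Sum>w\<in>pverts G. ennreal (\<omega> (u, w) / wdegree G \<omega> u) * hitting_time G \<omega> w v)"
    using pair_finite_verts hitting_time_self by (intro sum.mono_neutral_left) auto
  finally show ?thesis by (simp add: add.commute)
qed

text \<open>
  The hitting time is the least nonnegative solution: by induction on \<open>N\<close>, the sum of the first
  \<open>N\<close> tail probabilities lies below every such real solution. In particular it is finite as soon as
  there is a real solution.
\<close>
lemma hitting_time_le_solution:
  assumes h: "\<And>x. x \<in> pverts G \<Longrightarrow> 0 \<le> h x"
    and step: "\<And>x. x \<in> pverts G \<Longrightarrow> x \<noteq> v \<Longrightarrow>
      h x = 1 + (\<Sum>w\<in>pverts G. \<omega> (x, w) / wdegree G \<omega> x * h w)"
    and u: "u \<in> pverts G"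
  shows "hitting_time G \<omega> u v \<le> ennreal (h u)"
proof -
  let ?W = "pverts G - {v}"
  let ?s = "stay_prob G \<omega> ?W"
  have fin: "finite ?W" using pair_finite_verts by simp
  have "(\<Sum>n<N. ?s n u) \<le> ennreal (h u)" for N
    using u
  proof (induction N arbitrary: u)
    case 0
    then show ?case by simp
  next
    case (Suc N)
    show ?case
    proof (cases "u = v")
      case True
      have "?s n v = 0" for n
        by (cases n) (simp_all add: stay_prob_0 stay_prob_Suc pair_finite_verts)
      then show ?thesis using True by simp
    next
      case False
      have "(\<Sum>n<Suc N. ?s n u) = 1 + (\<Sum>n<N. ?s (Suc n) u)"
        using False Suc.prems fin by (subst sum.lessThan_Suc_shift) (simp add: stay_prob_0)
      also have "(\<Sum>n<N. ?s (Suc n) u) = (\<Sum>w\<in>?W. ennreal (pmf (rw_step G \<omega> u) w) * (\<Sum>n<N. ?s n w))"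
        using False Suc.prems by (simp add: stay_prob_Suc[OF fin] sum_distrib_left) (rule sum.swap)
      also have "1 + \<dots> \<le> 1 + (\<Sum>w\<in>?W. ennreal (pmf (rw_step G \<omega> u) w) * ennreal (h w))"
        using Suc.IH by (intro add_left_mono sum_mono mult_left_mono) auto
      also have "\<dots> \<le> 1 + (\<Sum>w\<in>pverts G. ennreal (pmf (rw_step G \<omega> u) w) * ennreal (h w))"
        using pair_finite_verts by (intro add_left_mono sum_mono2) auto
      also have "\<dots> = 1 + ennreal (\<Sum>w\<in>pverts G. pmf (rw_step G \<omega> u) w * h w)"
        using h by (simp add: ennreal_mult[symmetric] sum_ennreal)
      also have "\<dots> = ennreal (1 + (\<Sum>w\<in>pverts G. pmf (rw_step G \<omega> u) w * h w))"
        using h by (subst ennreal_plus) (auto intro!: sum_nonneg mult_nonneg_nonneg)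
      also have "\<dots> = ennreal (h u)"
        using step[OF Suc.prems False] Suc.prems by (simp add: pmf_rw_step degree)
      finally show ?thesis .
    qed
  qed
  then show ?thesis
    using u by (simp add: hitting_time_eq_stay_prob suminf_le_const)
qed

text \<open>
  The maximum principle: where \<open>g\<close> attains its maximum, outside \<open>v\<close>, it is a weighted
  mean of values that are not larger, so the maximum is attained at all out-neighbours. A path to
  \<open>v\<close> carries it to \<open>v\<close>, where \<open>g\<close> is zero.
\<close>
lemma harmonic_eq_0:
  assumes reach: "\<And>x. x \<in> pverts G \<Longrightarrow> (x, v) \<in> (parcs G)\<^sup>*"
    and gv: "g v = 0"
    and nonneg: "\<And>x. x \<in> pverts G \<Longrightarrow> 0 \<le> g x"
    and harmonic: "\<And>x. x \<in> pverts G \<Longrightarrow> x \<noteq> v \<Longrightarrow>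
      g x = (\<Sum>w\<in>pverts G. \<omega> (x, w) / wdegree G \<omega> x * g w)"
    and u: "u \<in> pverts G"
  shows "g u = (0 :: real)"
proof -
  define M where "M = Max (g ` pverts G)"
  have le: "g x \<le> M" if "x \<in> pverts G" for x
    using that pair_finite_verts by (auto simp: M_def)
  have "M \<in> g ` pverts G"
    unfolding M_def using u pair_finite_verts by (intro Max_in) auto
  then obtain z where z: "z \<in> pverts G" "g z = M" by auto
  have spread: "g y = M" if x: "x \<in> pverts G" "x \<noteq> v" "g x = M" and xy: "(x, y) \<in> parcs G" for x y
  proof -
    let ?q = "\<lambda>w. \<omega> (x, w) / wdegree G \<omega> x"
    have q: "0 \<le> ?q w" for w using weight_nonneg wdegree_nonneg by simp
    have "(\<Sum>w\<in>pverts G. ?q w) = 1"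
      using degree[OF x(1)] by (simp add: sum_divide_distrib[symmetric] wdegree_def[symmetric])
    moreover have "(\<Sum>w\<in>pverts G. ?q w * (M - g w)) = (\<Sum>w\<in>pverts G. ?q w) * M - g x"
      by (subst harmonic[OF x(1,2)]) (simp only: right_diff_distrib sum_subtractf sum_distrib_right)
    ultimately have "(\<Sum>w\<in>pverts G. ?q w * (M - g w)) = 0" using x(3) by simp
    moreover have "0 \<le> ?q w * (M - g w)" if "w \<in> pverts G" for w
      using q le[OF that] by (intro mult_nonneg_nonneg) auto
    moreover have y: "y \<in> pverts G" using xy by (rule in_arcsD2)
    ultimately have "?q y * (M - g y) = 0"
      using sum_nonneg_eq_0_iff[OF pair_finite_verts, of "\<lambda>w. ?q w * (M - g w)"] by blast
    moreover have "?q y \<noteq> 0" using weight_pos[OF xy] degree[OF x(1)] by simp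
    ultimately show ?thesis by simp
  qed
  have "g v = M"
    using reach[OF z(1)] z
  proof (induction rule: converse_rtrancl_induct)
    case (step x y)
    show ?case
    proof (cases "x = v")
      case False
      then show ?thesis using step spread[of x y] in_arcsD2[OF step(1)] by blast
    qed (use step in simp)
  qed
  then show ?thesis using le[OF u] nonneg[OF u] gv by simp
qed

text \<open>
  The difference of \<open>h\<close> and the hitting time is nonnegative, because the latter is the least
  solution, and harmonic.
\<close>
theorem hitting_time_unique_solution:
  assumes reach: "\<And>x. x \<in> pverts G \<Longrightarrow> (x, v) \<in> (parcs G)\<^sup>*"
    and hv: "h v = 0"
    and h: "\<And>x. x \<in> pverts G \<Longrightarrow> 0 \<le> h x"
    and step: "\<And>x. x \<in> pverts G \<Longrightarrow> x \<noteq> v \<Longrightarrow>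
      wdegree G \<omega> x * h x = wdegree G \<omega> x + (\<Sum>w\<in>pverts G. \<omega> (x, w) * h w)"
    and v: "v \<in> pverts G" and u: "u \<in> pverts G"
  shows "hitting_time G \<omega> u v = ennreal (h u)"
proof -
  have step': "h x = 1 + (\<Sum>w\<in>pverts G. \<omega> (x, w) / wdegree G \<omega> x * h w)"
    if x: "x \<in> pverts G" "x \<noteq> v" for x
  proof -
    have "wdegree G \<omega> x * h x =
        wdegree G \<omega> x * (1 + (\<Sum>w\<in>pverts G. \<omega> (x, w) / wdegree G \<omega> x * h w))"
      using degree[OF x(1)] by (simp add: step[OF x] distrib_left sum_distrib_left)
    then show ?thesis using degree[OF x(1)] by simp
  qed
  define k where "k x = enn2real (hitting_time G \<omega> x v)" for x
  have fin: "hitting_time G \<omega> x v < top" and le: "k x \<le> h x" if x: "x \<in> pverts G" for x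
  proof -
    have *: "hitting_time G \<omega> x v \<le> ennreal (h x)"
      using h step' x by (rule hitting_time_le_solution)
    then show "hitting_time G \<omega> x v < top" by (rule le_less_trans) simp
    show "k x \<le> h x" unfolding k_def using enn2real_mono[OF *] h[OF x] by simp
  qed
  have k: "hitting_time G \<omega> x v = ennreal (k x)" if "x \<in> pverts G" for x
    using fin[OF that] by (simp add: k_def)
  have k0: "0 \<le> k x" for x by (simp add: k_def)
  have kstep: "k x = 1 + (\<Sum>w\<in>pverts G. \<omega> (x, w) / wdegree G \<omega> x * k w)"
    if x: "x \<in> pverts G" "x \<noteq> v" for x
  proof -
    let ?q = "\<lambda>w. \<omega> (x, w) / wdegree G \<omega> x"
    have q: "0 \<le> ?q w" for w using weight_nonneg wdegree_nonneg by simp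
    have s: "0 \<le> (\<Sum>w\<in>pverts G. ?q w * k w)"
      by (intro sum_nonneg mult_nonneg_nonneg q k0)
    have "ennreal (k x) = 1 + (\<Sum>w\<in>pverts G. ennreal (?q w) * ennreal (k w))"
      using hitting_time_step[OF x] k x(1) by simp
    also have "\<dots> = 1 + ennreal (\<Sum>w\<in>pverts G. ?q w * k w)"
      unfolding sum_ennreal[OF mult_nonneg_nonneg[OF q k0], symmetric] ennreal_mult[OF q k0] ..
    also have "\<dots> = ennreal (1 + (\<Sum>w\<in>pverts G. ?q w * k w))"
      by (simp only: ennreal_plus[OF zero_le_one s] ennreal_1)
    finally show ?thesis using s k0 by (subst (asm) ennreal_inj) auto
  qed
  have "h u - k u = 0"
  proof (rule harmonic_eq_0[OF reach, of "\<lambda>x. h x - k x"])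
    show "h v - k v = 0" using hv hitting_time_self[OF v] by (simp add: k_def)
    show "0 \<le> h x - k x" if "x \<in> pverts G" for x using le[OF that] by simp
    show "h x - k x = (\<Sum>w\<in>pverts G. \<omega> (x, w) / wdegree G \<omega> x * (h w - k w))"
      if "x \<in> pverts G" "x \<noteq> v" for x
      using step'[OF that] kstep[OF that] by (simp add: right_diff_distrib sum_subtractf)
  qed (use u in auto)
  then show ?thesis using k[OF u] by simp
qed

end

end

section \<open>The hitting time formulas\<close>

lemma (in weighted_arcs) sum_sep_sum:
  "(\<Sum>r\<in>V - {v}. d r * sep_sum v r u) =
    (\<Sum>(r, A)\<in>(SIGMA r:V - {v}. {A \<in> in_forests V E {v, r}. (u, r) \<in> A\<^sup>*}). d r * prod \<omega> A)"
proof -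
  have fin: "finite (in_forests V E R)" for R by (rule finite_in_forests[OF finite_E])
  have "sep_sum v r u = (\<Sum>A\<in>{A \<in> in_forests V E {v, r}. (u, r) \<in> A\<^sup>*}. prod \<omega> A)" for r
    unfolding sep_sum_def using fin by (intro sum.mono_neutral_cong_right) auto
  then have "(\<Sum>r\<in>V - {v}. d r * sep_sum v r u) =
      (\<Sum>r\<in>V - {v}. \<Sum>A\<in>{A \<in> in_forests V E {v, r}. (u, r) \<in> A\<^sup>*}. d r * prod \<omega> A)"
    by (simp add: sum_distrib_left)
  also have "\<dots> = (\<Sum>(r, A)\<in>(SIGMA r:V - {v}. {A \<in> in_forests V E {v, r}. (u, r) \<in> A\<^sup>*}). d r * prod \<omega> A)"
    using finite_V fin by (intro sum.Sigma) auto
  finally show ?thesis .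
qed

sublocale weighted_digraph \<subseteq> W: weighted_arcs "pverts G" "parcs G" \<omega>
  by unfold_locales (use pair_finite_verts arcs_subset weight_zero in auto)

context weighted_digraph
begin

lemma rooted_tree_weight_eq:
  assumes "w \<in> V" shows "rooted_tree_weight G \<omega> w = W.tree_sum w"
  using trees_with_root_eq[OF assms]
  by (simp add: rooted_tree_weight_def W.tree_sum_def sum.reindex inj_on_def forest_weight_def)

text \<open>
  A triple of the index set is determined by its forest and the root of its second component, which can be read
  off.
\<close>
lemma rooted_2_forests_sum:
  assumes v: "v \<in> V" and u: "u \<in> V"
  shows "(\<Sum>(F, T1, T2)\<in>rooted_2_forests_sep G u v. d (component_root F T2) * forest_weight \<omega> F) =
    (\<Sum>r\<in>V - {v}. d r * W.sep_sum v r u)"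
proof -
  let ?S = "SIGMA r:V - {v}. {A \<in> in_forests V E {v, r}. (u, r) \<in> A\<^sup>*}"
  let ?f = "\<lambda>(r, A). (digraph_on V A, {x \<in> V. (x, v) \<in> A\<^sup>*}, {x \<in> V. (x, r) \<in> A\<^sup>*})"
  have root: "component_root (digraph_on V A) {x \<in> V. (x, r) \<in> A\<^sup>*} = r"
    if "r \<in> V" "A \<in> in_forests V E {v, r}" for r A
    using component_root_in_forest[OF pair_finite_arcs arcs_subset, of A "{v, r}" r] that v by auto
  have "inj_on ?f ?S"
    by (rule inj_on_inverseI[where g = "\<lambda>(F, T1, T2). (component_root F T2, parcs F)"])
       (use root in auto)
  then have "(\<Sum>(F, T1, T2)\<in>rooted_2_forests_sep G u v. d (component_root F T2) * forest_weight \<omega> F) =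
      (\<Sum>(r, A)\<in>?S. d r * prod \<omega> A)"
    unfolding rooted_2_forests_sep_eq[OF v u]
    by (subst sum.reindex) (use root in \<open>auto simp: forest_weight_def intro!: sum.cong\<close>)
  then show ?thesis by (simp only: W.sum_sep_sum)
qed

lemma trees_containing_sum:
  assumes e: "(v, u) \<in> E"
  shows "(\<Sum>T\<in>trees_containing G (v, u). d (tree_root T) * forest_weight \<omega> T) =
    \<omega> (v, u) * (\<Sum>r\<in>V - {v}. d r * W.sep_sum v r u)"
proof -
  let ?S = "SIGMA r:V - {v}. {A \<in> in_forests V E {r}. (v, u) \<in> A}"
  have v: "v \<in> V" using e by (rule in_arcsD1)
  have "r \<noteq> v" if "A \<in> in_forests V E {r}" "(v, u) \<in> A" for r A
    using in_forestsD(4)[OF that(1)] that(2) by auto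
  then have eq: "trees_containing G (v, u) = (\<lambda>(r, A). digraph_on V A) ` ?S"
    unfolding trees_containing_def rooted_trees_eq by force
  have "inj_on (\<lambda>(r, A). digraph_on V A) ?S"
    by (rule inj_on_inverseI[where g = "\<lambda>T. (tree_root T, parcs T)"]) (auto simp: tree_root_in_tree)
  then have "(\<Sum>T\<in>trees_containing G (v, u). d (tree_root T) * forest_weight \<omega> T) =
      (\<Sum>(r, A)\<in>?S. d r * prod \<omega> A)"
    unfolding eq by (subst sum.reindex) (auto simp: tree_root_in_tree forest_weight_def intro!: sum.cong)
  also have "\<dots> = (\<Sum>r\<in>V - {v}. \<Sum>A | A \<in> in_forests V E {r} \<and> (v, u) \<in> A. d r * prod \<omega> A)"
    using pair_finite_verts finite_in_forests[OF pair_finite_arcs] by (intro sum.Sigma[symmetric]) auto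
  also have "\<dots> = (\<Sum>r\<in>V - {v}. d r * (\<omega> (v, u) * W.sep_sum v r u))"
    using W.trees_with_arc_eq_sep_sum[OF e] by (intro sum.cong) (auto simp: sum_distrib_left[symmetric])
  finally show ?thesis by (simp add: sum_distrib_left mult_ac)
qed

lemma wdegree_pos:
  assumes "strongly_connected (with_proj G)" "x \<in> V"
  shows "0 < wdegree G \<omega> x"
proof -
  have "V \<noteq> {x}" using at_least_two_verts by auto
  then obtain y where y: "y \<in> V" "y \<noteq> x" using assms(2) by blast
  then have "(x, y) \<in> E\<^sup>*"
    using assms reachable_rtranclI[of "with_proj G" x y] by (auto simp: strongly_connected_def)
  then obtain z where z: "(x, z) \<in> E" using y(2) by (auto elim: converse_rtranclE)
  then show ?thesis
    unfolding wdegree_def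
    using weight_pos[OF z] in_arcsD2[OF z] weight_nonneg pair_finite_verts by (intro sum_pos2) auto
qed

theorem hitting_time_eq_sep_sum:
  assumes sc: "strongly_connected (with_proj G)" and v: "v \<in> V" and u: "u \<in> V"
  shows "hitting_time G \<omega> u v =
    ennreal (1 / W.tree_sum v * (\<Sum>r\<in>V - {v}. wdegree G \<omega> r * W.sep_sum v r u))"
proof (rule hitting_time_unique_solution[where v = v and
      h = "\<lambda>x. 1 / W.tree_sum v * (\<Sum>r\<in>V - {v}. wdegree G \<omega> r * W.sep_sum v r x)"])
  show reach: "(x, v) \<in> E\<^sup>*" if "x \<in> V" for x
    using sc that v reachable_rtranclI[of "with_proj G" x v] by (auto simp: strongly_connected_def)
  have pos: "0 < W.tree_sum v" using reach weight_pos by (rule W.tree_sum_pos)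
  show "wdegree G \<omega> x \<noteq> 0" if "x \<in> V" for x using wdegree_pos[OF sc that] by simp
  show "1 / W.tree_sum v * (\<Sum>r\<in>V - {v}. wdegree G \<omega> r * W.sep_sum v r v) = 0"
    by (simp add: W.sep_sum_target)
  show "0 \<le> 1 / W.tree_sum v * (\<Sum>r\<in>V - {v}. wdegree G \<omega> r * W.sep_sum v r x)" for x
    unfolding W.sep_sum_def using pos
    by (intro mult_nonneg_nonneg sum_nonneg prod_nonneg wdegree_nonneg weight_nonneg) auto
  show "wdegree G \<omega> x * (1 / W.tree_sum v * (\<Sum>r\<in>V - {v}. wdegree G \<omega> r * W.sep_sum v r x)) =
      wdegree G \<omega> x +
      (\<Sum>w\<in>V. \<omega> (x, w) * (1 / W.tree_sum v * (\<Sum>r\<in>V - {v}. wdegree G \<omega> r * W.sep_sum v r w)))"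
    if "x \<in> V" "x \<noteq> v" for x
  proof -
    let ?S = "\<lambda>x. \<Sum>r\<in>V - {v}. wdegree G \<omega> r * W.sep_sum v r x"
    have "wdegree G \<omega> x * (1 / W.tree_sum v * ?S x) = 1 / W.tree_sum v * (wdegree G \<omega> x * ?S x)"
      by simp
    also have "wdegree G \<omega> x * ?S x = wdegree G \<omega> x * W.tree_sum v + (\<Sum>w\<in>V. \<omega> (x, w) * ?S w)"
      using W.sep_sum_system[OF that, of "wdegree G \<omega>"] by (simp add: wdegree_def)
    also have "1 / W.tree_sum v * \<dots> =
        wdegree G \<omega> x + (\<Sum>w\<in>V. 1 / W.tree_sum v * (\<omega> (x, w) * ?S w))"
      using pos by (simp only: distrib_left sum_distrib_left[symmetric]) simp
    finally show ?thesis by (simp only: mult.left_commute)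
  qed
qed (use v u in auto)

end

context weighted_graph
begin

lemma arcs_sym: "sym E"
proof (rule symI)
  fix a b assume "(a, b) \<in> E"
  then have "\<omega> (b, a) > 0" using weight_pos weight_sym[of b a] by simp
  then show "(b, a) \<in> E" using weight_zero by force
qed

lemma connected_imp_strongly_connected:
  assumes "Digraph_Component.connected (with_proj G)" shows "strongly_connected (with_proj G)"
proof -
  have "mk_symmetric (with_proj G) = G"
    using arcs_sym by (auto simp: mk_symmetric_def sym_def intro!: pair_pre_digraph.equality)
  then show ?thesis using assms by (simp add: connected_def)
qed

lemma undirected_weight_in_forest:
  assumes "A \<in> in_forests V E R"
  shows "undirected_forest_weight \<omega> (digraph_on V (A \<union> A\<inverse>)) = prod \<omega> A"
  using in_forests_no_antiparallel[OF assms] weight_sym by (intro undirected_forest_weight_symcl) auto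

lemma spanning_tree_weight_eq:
  assumes v: "v \<in> V"
  shows "spanning_tree_weight G \<omega> = W.tree_sum v"
proof -
  have "inj_on (\<lambda>A. digraph_on V (A \<union> A\<inverse>)) (in_forests V E {v})"
    by (rule inj_on_inverseI[where g = "\<lambda>F. orient (parcs F) {v}"])
       (use symcl_in_forest(2)[OF pair_finite_arcs arcs_subset arcs_sym] v in auto)
  then show ?thesis
    unfolding spanning_tree_weight_def unrooted_trees_eq[OF arcs_sym v] W.tree_sum_def
    by (subst sum.reindex) (auto simp: undirected_weight_in_forest)
qed

text \<open>
  The volume is expanded into a sum over the vertices \<open>r\<close> of \<open>T2\<close>. The forests
  together with such a vertex are then replaced by the rooted forests with roots \<open>v\<close> and
  \<open>r\<close>.
\<close>
lemma unrooted_2_forests_sum: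
  assumes v: "v \<in> V" and u: "u \<in> V"
  shows "(\<Sum>(F, T1, T2)\<in>unrooted_2_forests_sep G u v. vol G \<omega> T2 * undirected_forest_weight \<omega> F) =
    (\<Sum>r\<in>V - {v}. wdegree G \<omega> r * W.sep_sum v r u)"
proof -
  let ?S = "SIGMA r:V - {v}. {A \<in> in_forests V E {v, r}. (u, r) \<in> A\<^sup>*}"
  let ?f = "\<lambda>(r, A). ((digraph_on V (A \<union> A\<inverse>), {x \<in> V. (x, v) \<in> A\<^sup>*}, {x \<in> V. (x, r) \<in> A\<^sup>*}), r)"
  let ?U = "unrooted_2_forests_sep G u v"
  let ?P = "SIGMA t:?U. snd (snd t)"
  note P = unrooted_2_forests_sep_pointed_eq[OF arcs_sym v u]
  have "finite ?S"
    using pair_finite_verts finite_in_forests[OF pair_finite_arcs] by (intro finite_SigmaI) auto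
  then have finP: "finite ?P" unfolding P by (rule finite_imageI)
  have U: "?U = fst ` ?P" unfolding fst_image_Sigma by (auto simp: unrooted_2_forests_sep_def)
  have finU: "finite ?U" by (subst U) (rule finite_imageI[OF finP])
  have finT: "finite (snd (snd t))" if t: "t \<in> ?U" for t
  proof (rule finite_subset[OF _ finite_imageI[OF finP, of snd]])
    show "snd (snd t) \<subseteq> snd ` ?P"
    proof
      fix r assume "r \<in> snd (snd t)"
      then have "(t, r) \<in> ?P" using t by (rule SigmaI[rotated])
      then show "r \<in> snd ` ?P" by (rule rev_image_eqI) simp
    qed
  qed
  have "(\<Sum>(F, T1, T2)\<in>?U. vol G \<omega> T2 * undirected_forest_weight \<omega> F) =
      (\<Sum>t\<in>?U. \<Sum>r\<in>snd (snd t). wdegree G \<omega> r * undirected_forest_weight \<omega> (fst t))"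
    by (intro sum.cong) (auto simp: vol_def sum_distrib_right)
  also have "\<dots> = (\<Sum>(t, r)\<in>?P. wdegree G \<omega> r * undirected_forest_weight \<omega> (fst t))"
    using finU finT by (intro sum.Sigma) auto
  also have "\<dots> = (\<Sum>(r, A)\<in>?S. wdegree G \<omega> r * prod \<omega> A)"
  proof -
    have "inj_on ?f ?S"
    proof (rule inj_on_inverseI[where g = "\<lambda>((F, T1, T2), r). (r, orient (parcs F) {v, r})"])
      fix p assume "p \<in> ?S"
      then obtain r A where "p = (r, A)" "A \<in> in_forests V E {v, r}" "r \<in> V" by blast
      then show "(\<lambda>((F, T1, T2), r). (r, orient (parcs F) {v, r})) (?f p) = p"
        using symcl_in_forest(2)[OF pair_finite_arcs arcs_subset arcs_sym, of "{v, r}" A] v by simp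
    qed
    then show ?thesis
      unfolding P by (subst sum.reindex) (auto simp: undirected_weight_in_forest intro!: sum.cong)
  qed
  also have "\<dots> = (\<Sum>r\<in>V - {v}. wdegree G \<omega> r * W.sep_sum v r u)"
    by (rule W.sum_sep_sum[symmetric])
  finally show ?thesis .
qed

end

theorem theorem4p1:
  fixes G :: "'v pair_pre_digraph" and \<omega> :: "'v \<times> 'v \<Rightarrow> real"
  shows
    "(weighted_digraph G \<omega> \<and> strongly_connected G \<longrightarrow>
        (\<forall>u\<in>pverts G. \<forall>v\<in>pverts G.
           hitting_time G \<omega> u v =
             ennreal (1 / rooted_tree_weight G \<omega> v *
               (\<Sum>(F, T1, T2)\<in>rooted_2_forests_sep G u v.
                  wdegree G \<omega> (component_root F T2) * forest_weight \<omega> F)))) \<and>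
     (weighted_digraph G \<omega> \<and> strongly_connected G \<longrightarrow>
        (\<forall>u\<in>pverts G. \<forall>v\<in>pverts G. (v, u) \<in> parcs G \<longrightarrow>
           hitting_time G \<omega> u v =
             ennreal (1 / (rooted_tree_weight G \<omega> v * \<omega> (v, u)) *
               (\<Sum>T\<in>trees_containing G (v, u).
                  wdegree G \<omega> (tree_root T) * forest_weight \<omega> T)))) \<and>
     (weighted_graph G \<omega> \<and> Digraph_Component.connected G \<longrightarrow>
        (\<forall>u\<in>pverts G. \<forall>v\<in>pverts G.
           hitting_time G \<omega> u v =
             ennreal (1 / spanning_tree_weight G \<omega> *
               (\<Sum>(F, T1, T2)\<in>unrooted_2_forests_sep G u v.
                  vol G \<omega> T2 * undirected_forest_weight \<omega> F))))"
proof (intro conjI impI ballI)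
  fix u v assume "weighted_digraph G \<omega> \<and> strongly_connected (with_proj G)"
    and uv: "u \<in> pverts G" "v \<in> pverts G"
  then interpret weighted_digraph G \<omega> by simp
  have sc: "strongly_connected (with_proj G)" using \<open>weighted_digraph G \<omega> \<and> _\<close> by simp
  note H = hitting_time_eq_sep_sum[OF sc uv(2,1)]
  show "hitting_time G \<omega> u v = ennreal (1 / rooted_tree_weight G \<omega> v *
      (\<Sum>(F, T1, T2)\<in>rooted_2_forests_sep G u v.
        wdegree G \<omega> (component_root F T2) * forest_weight \<omega> F))"
    by (simp only: H rooted_tree_weight_eq[OF uv(2)] rooted_2_forests_sum[OF uv(2,1)])
  assume e: "(v, u) \<in> parcs G"
  have "\<omega> (v, u) \<noteq> 0" using weight_pos[OF e] by simp
  then show "hitting_time G \<omega> u v = ennreal (1 / (rooted_tree_weight G \<omega> v * \<omega> (v, u)) *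
      (\<Sum>T\<in>trees_containing G (v, u). wdegree G \<omega> (tree_root T) * forest_weight \<omega> T))"
    unfolding trees_containing_sum[OF e] H rooted_tree_weight_eq[OF uv(2)] by simp
next
  fix u v assume "weighted_graph G \<omega> \<and> Digraph_Component.connected (with_proj G)"
    and uv: "u \<in> pverts G" "v \<in> pverts G"
  then interpret weighted_graph G \<omega> by simp
  have sc: "strongly_connected (with_proj G)"
    using \<open>weighted_graph G \<omega> \<and> _\<close> by (simp add: connected_imp_strongly_connected)
  show "hitting_time G \<omega> u v = ennreal (1 / spanning_tree_weight G \<omega> *
      (\<Sum>(F, T1, T2)\<in>unrooted_2_forests_sep G u v. vol G \<omega> T2 * undirected_forest_weight \<omega> F))"
    by (simp only: hitting_time_eq_sep_sum[OF sc uv(2,1)] spanning_tree_weight_eq[OF uv(2)]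
      unrooted_2_forests_sum[OF uv(2,1)])
qed

end
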